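(* The formulas $$\cosh R=\operatorname{sn}(\beta,q),\qquad \sinh R=i\operatorname{cn}(\beta,q),\qquad \sinh r=i\operatorname{dn}(\beta,q),$$ or, in terms of $\gamma$ with $\beta=\gamma+iK'$, $$\cosh R=\frac{1}{q\operatorname{sn}(\gamma,q)},\qquad \tanh R=\operatorname{dn}(\gamma,q),\qquad \sinh r=\frac{\operatorname{cn}(\gamma,q)}{\operatorname{sn}(\gamma,q)},$$ describe a one-to-one correspondence between the radii $(r,R)\in[-\infty,+\infty]\times[R_0,+\infty]$ of a hyperbolic ring with the parameter $q\le1$ given by $\cosh r=q\cosh R$ and the variable $\beta=\gamma+iK'$ with $\gamma\in[0,2K]$ of Jacobi functions of modulus $q$. Here $\cosh R_0=1/q$. The sign is controlled by requiring $r=R$ for $q=1$.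
   Context: $\operatorname{sn},\operatorname{cn},\operatorname{dn}$ are the Jacobi elliptic functions of modulus $q$, and $K,K'$ are the complete elliptic integrals of the first kind of modulus $q$ and of the complementary modulus; for $q=1$ one has $\operatorname{sn}=\tanh$, $\operatorname{cn}=\operatorname{dn}=1/\cosh$, $K'=\pi/2$, $K=\infty$. A hyperbolic ring is a pair of concentric circles in the hyperbolic plane forming an annulus, with inner hyperbolic radius $r$ (signed, the sign encoding orientation, so $r$ may be negative) and outer hyperbolic radius $R>0$. All rings of a hyperbolic orthogonal ring pattern (neighboring rings intersect orthogonally, i.e. the outer circle of each intersects the inner circle of the other orthogonally) satisfy $\cosh r=q\cosh R$ with one global constant $q\le1$. *)

theory Defs
  imports "HOL-Complex_Analysis.Complex_Analysis"
begin

text \<open>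
  All elliptic integrals and functions take the modulus \<open>q\<close> (not the parameter \<open>q\<^sup>2\<close>).
  The complete integral is extended-real valued, so that it is \<open>\<infinity>\<close> for \<open>q = 1\<close>.
\<close>

definition elliptic_K :: "real \<Rightarrow> ereal" where
  "elliptic_K q =
     enn2ereal (\<integral>\<^sup>+\<theta>\<in>{0..pi/2}. ennreal (1 / sqrt (1 - q\<^sup>2 * (sin \<theta>)\<^sup>2)) \<partial>lborel)"

text \<open>\<open>K'\<close> is finite for \<open>0 < q \<le> 1\<close>, and is used as a real number in that range only.\<close>

definition elliptic_K' :: "real \<Rightarrow> real" where
  "elliptic_K' q = real_of_ereal (elliptic_K (sqrt (1 - q\<^sup>2)))"

definition elliptic_F :: "real \<Rightarrow> real \<Rightarrow> real" where
  "elliptic_F q \<phi> = (LBINT \<theta>=0..\<phi>. 1 / sqrt (1 - q\<^sup>2 * (sin \<theta>)\<^sup>2))"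

text \<open>
  The amplitude is the inverse of \<^term>\<open>elliptic_F q\<close>. For \<open>q = 1\<close> the integral diverges at
  \<open>\<plusminus>\<pi>/2\<close>, and \<^term>\<open>elliptic_F 1\<close> maps the open interval between them onto the real line.
\<close>

definition jacobi_am :: "real \<Rightarrow> real \<Rightarrow> real" where
  "jacobi_am q u = (THE \<phi>. (q = 1 \<longrightarrow> \<bar>\<phi>\<bar> < pi/2) \<and> elliptic_F q \<phi> = u)"

text \<open>
  The meromorphic continuation of a function on the real line to the complex plane.
  The library's convention for \<open>nicely_meromorphic_on\<close> is that the function has the value 0 at
  its poles and no removable singularities, which makes the continuation unique.
\<close>

definition mero_continuation :: "(real \<Rightarrow> real) \<Rightarrow> complex \<Rightarrow> complex" where
  "mero_continuation f =
     (THE g. g nicely_meromorphic_on UNIV \<and> (\<forall>x. g (complex_of_real x) = complex_of_real (f x)))"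

definition jacobi_sn :: "real \<Rightarrow> complex \<Rightarrow> complex" where
  "jacobi_sn q = mero_continuation (\<lambda>u. sin (jacobi_am q u))"

definition jacobi_cn :: "real \<Rightarrow> complex \<Rightarrow> complex" where
  "jacobi_cn q = mero_continuation (\<lambda>u. cos (jacobi_am q u))"

definition jacobi_dn :: "real \<Rightarrow> complex \<Rightarrow> complex" where
  "jacobi_dn q = mero_continuation (\<lambda>u. sqrt (1 - q\<^sup>2 * (sin (jacobi_am q u))\<^sup>2))"

definition ecosh :: "ereal \<Rightarrow> ereal" where
  "ecosh x = (case x of ereal t \<Rightarrow> ereal (cosh t) | PInfty \<Rightarrow> \<infinity> | MInfty \<Rightarrow> \<infinity>)"

definition esinh :: "ereal \<Rightarrow> ereal" where
  "esinh x = (case x of ereal t \<Rightarrow> ereal (sinh t) | PInfty \<Rightarrow> \<infinity> | MInfty \<Rightarrow> -\<infinity>)"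

definition etanh :: "ereal \<Rightarrow> ereal" where
  "etanh x = (case x of ereal t \<Rightarrow> ereal (tanh t) | PInfty \<Rightarrow> 1 | MInfty \<Rightarrow> -1)"

text \<open>
  \<open>ext_value b f \<gamma> v\<close>: the function \<open>f\<close>, considered on the open interval from 0 to \<open>b\<close>, has the
  extended real value \<open>v\<close> at the point \<open>\<gamma>\<close> of the closed interval. In the interior this is equality
  of complex numbers; at an endpoint, which may be a pole of \<open>f\<close> or be infinite, \<open>f\<close> is real
  valued on the open interval and \<open>v\<close> is its one-sided limit.
\<close>

definition ext_value :: "ereal \<Rightarrow> (real \<Rightarrow> complex) \<Rightarrow> ereal \<Rightarrow> ereal \<Rightarrow> bool" where
  "ext_value b f \<gamma> v \<longleftrightarrow>
     (if 0 < \<gamma> \<and> \<gamma> < b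
      then \<exists>y::real. v = ereal y \<and> complex_of_real y = f (real_of_ereal \<gamma>)
      else (\<forall>t. 0 < ereal t \<and> ereal t < b \<longrightarrow> f t \<in> \<real>) \<and>
           ((\<lambda>s. ereal (Re (f (real_of_ereal s)))) \<longlongrightarrow> v) (at \<gamma> within {0<..<b}))"

text \<open>
  The radii \<open>(r, R)\<close> of the rings with parameter \<open>q\<close>. For \<open>q = 1\<close> the equation only gives
  \<open>r = R\<close> or \<open>r = -R\<close>, and the sign is fixed by requiring \<open>r = R\<close>.
\<close>

definition ring_radii :: "real \<Rightarrow> real \<Rightarrow> (ereal \<times> ereal) set" where
  "ring_radii q R\<^sub>0 =
     {(r, R). ereal R\<^sub>0 \<le> R \<and> ecosh r = ereal q * ecosh R \<and> (q = 1 \<longrightarrow> r = R)}"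

end

theory Submission
  imports Defs
begin

text \<open>
  On the real line everything is a function of the amplitude \<open>\<phi> = am \<gamma>\<close>, which increases from 0 to \<open>\<pi>\<close>
  on \<open>[0, 2K]\<close> (for \<open>q = 1\<close>, from 0 to \<open>\<pi>/2\<close> on \<open>[0, \<infinity>]\<close>). The second set of formulas reads
  \<open>cosh R = 1 / (q sin \<phi>)\<close>, \<open>tanh R = \<Delta>(\<phi>)\<close>, \<open>sinh r = cot \<phi>\<close> with
  \<open>\<Delta>(\<phi>) = sqrt (1 - q\<^sup>2 sin\<^sup>2 \<phi>)\<close>. As \<open>cot\<close> maps \<open>(0, \<pi>)\<close> bijectively onto the real
  line and \<open>(0, \<pi>/2)\<close> onto the positive half-line, the inner radius determines \<open>\<phi>\<close> and conversely. From \<open>cosh r = 1 / sin \<phi>\<close> one gets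
  \<open>cosh r = q cosh R\<close>, and \<open>R\<close> is the nonnegative solution of this equation. At the ends of the
  interval \<open>sin \<phi>\<close> tends to 0 and the radii become infinite, except at the right end for \<open>q = 1\<close>,
  where both tend to 0 (\<open>bij_betw_ring_of_variable\<close>, \<open>ext_value_ring_of_variable\<close>).

  The first set of formulas is the second one, because of
  \<open>sn(\<gamma> + iK') = 1 / (q sn \<gamma>)\<close>, \<open>i cn(\<gamma> + iK') = dn \<gamma> / (q sn \<gamma>)\<close> and
  \<open>i dn(\<gamma> + iK') = cn \<gamma> / sn \<gamma>\<close>. The work lies in giving these a meaning: the complex functions are
  defined as meromorphic continuations, whose existence must be shown. They are written down
  explicitly, by the formulas that express \<open>sn(x + iy)\<close> through real functions of modulus \<open>q\<close> at \<open>x\<close>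
  and of the complementary modulus at \<open>y\<close>. The differential equations of the real functions yield
  the Cauchy-Riemann equations where the denominator is nonzero
  (\<open>complex_jacobi_field_differentiable\<close>). At a zero of the denominator the functions are quotients
  of their own translates by a quarter period, which are analytic there
  (\<open>quarter_period_relations\<close>), so that the singularity is a pole. Uniqueness is the identity theorem
  (\<open>nicely_meromorphic_eqI\<close>). Evaluating the explicit formulas on the lines \<open>y = 0\<close> and \<open>y = K'\<close>
  gives all values that are needed (\<open>jacobi_sn_real\<close>, \<open>jacobi_sn_shift\<close>).
\<close>

section \<open>Explicit complex Jacobi functions\<close>

text \<open>
  The differential equations and quadratic relations of real \<open>sn, cn, dn\<close> of modulus \<open>k\<close>, without
  the initial values: in this way translates are included.
\<close>

definition jacobi_triple :: "real \<Rightarrow> (real \<Rightarrow> real) \<Rightarrow> (real \<Rightarrow> real) \<Rightarrow> (real \<Rightarrow> real) \<Rightarrow> bool" where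
  "jacobi_triple k s c d \<longleftrightarrow>
     (\<forall>x. (s has_real_derivative c x * d x) (at x) \<and>
          (c has_real_derivative - s x * d x) (at x) \<and>
          (d has_real_derivative - k\<^sup>2 * s x * c x) (at x) \<and>
          (s x)\<^sup>2 + (c x)\<^sup>2 = 1 \<and> (d x)\<^sup>2 + k\<^sup>2 * (s x)\<^sup>2 = 1)"

lemma jacobi_triple_dn_nonzero:
  assumes t: "jacobi_triple k' s c d" and k: "k > 0" "k\<^sup>2 + k'\<^sup>2 = 1"
  shows "d y \<noteq> 0"
proof -
  have "(s y)\<^sup>2 + (c y)\<^sup>2 = 1" "(d y)\<^sup>2 + k'\<^sup>2 * (s y)\<^sup>2 = 1"
    using t by (auto simp: jacobi_triple_def)
  then have "(d y)\<^sup>2 = k\<^sup>2 + k'\<^sup>2 * (c y)\<^sup>2" using k(2) by algebra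
  moreover have "k\<^sup>2 > 0" using k by simp
  ultimately show ?thesis
    by (metis add_pos_nonneg less_irrefl mult_nonneg_nonneg power_zero_numeral zero_le_power2)
qed

text \<open>
  The functions \<open>cd, -k sd, k nd\<close> are the translates of \<open>sn, cn, dn\<close> of modulus \<open>k'\<close> by a quarter
  period; that they satisfy the same relations is checked by differentiating. They supply the complex
  functions translated by \<open>iK'\<close>.
\<close>

lemma jacobi_triple_quarter_shift:
  assumes t: "jacobi_triple k' s c d" and k: "k > 0" "k\<^sup>2 + k'\<^sup>2 = 1"
  shows "jacobi_triple k' (\<lambda>y. c y / d y) (\<lambda>y. - k * s y / d y) (\<lambda>y. k / d y)"
proof -
  have nz: "d y \<noteq> 0" for y
    by (rule jacobi_triple_dn_nonzero[OF t k])
  have sc: "(s y)\<^sup>2 + (c y)\<^sup>2 = 1" and ds: "(d y)\<^sup>2 + k'\<^sup>2 * (s y)\<^sup>2 = 1" for y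
    using t by (auto simp: jacobi_triple_def)
  have der: "(s has_real_derivative c x * d x) (at x)"
          "(c has_real_derivative - s x * d x) (at x)"
          "(d has_real_derivative - k'\<^sup>2 * s x * c x) (at x)" for x
    using t by (auto simp: jacobi_triple_def)
  have 1: "((\<lambda>y. c y / d y) has_real_derivative - k * s x / d x * (k / d x)) (at x)" for x
    apply (rule derivative_eq_intros der nz refl)+
    using nz[of x] sc[of x] ds[of x] k(2) by (simp add: divide_simps) algebra
  have 2: "((\<lambda>y. - k * s y / d y) has_real_derivative - (c x / d x) * (k / d x)) (at x)" for x
    apply (rule derivative_eq_intros der nz refl)+
    using nz[of x] sc[of x] ds[of x] k(2) by (simp add: divide_simps) algebra
  have 3: "((\<lambda>y. k / d y) has_real_derivative - k'\<^sup>2 * (c x / d x) * (- k * s x / d x)) (at x)" for x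
    apply (rule derivative_eq_intros der nz refl)+
    using nz[of x] sc[of x] ds[of x] k(2) by (simp add: divide_simps)
  have 4: "(c x / d x)\<^sup>2 + (- k * s x / d x)\<^sup>2 = 1" for x
    using nz[of x] sc[of x] ds[of x] k(2) by (simp add: divide_simps power_mult_distrib power_divide) algebra
  have 5: "(k / d x)\<^sup>2 + k'\<^sup>2 * (c x / d x)\<^sup>2 = 1" for x
    using nz[of x] sc[of x] ds[of x] k(2) by (simp add: divide_simps power_mult_distrib power_divide) algebra
  show ?thesis unfolding jacobi_triple_def using 1 2 3 4 5 by blast
qed

text \<open>
  The Cauchy-Riemann equations for \<open>(A + iB) / D\<close>, multiplied by \<open>D\<^sup>2\<close>. In this form they are
  polynomial in the values and partial derivatives of \<open>A, B, D\<close>.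
\<close>

lemma quotient_field_differentiable:
  fixes A B D :: "complex \<Rightarrow> real"
  assumes A: "(A has_derivative (\<lambda>h. Ax * Re h + Ay * Im h)) (at z)"
    and B: "(B has_derivative (\<lambda>h. Bx * Re h + By * Im h)) (at z)"
    and D: "(D has_derivative (\<lambda>h. Dx * Re h + Dy * Im h)) (at z)"
    and nz: "D z \<noteq> 0"
    and cr: "(Ay + Bx) * D z = A z * Dy + B z * Dx" "(By - Ax) * D z = B z * Dy - A z * Dx"
  shows "(\<lambda>w. Complex (A w) (B w) / of_real (D w)) field_differentiable (at z)"
proof -
  define u where "u = (Ax * D z - A z * Dx) / (D z)\<^sup>2"
  define v where "v = (Bx * D z - B z * Dx) / (D z)\<^sup>2"
  have "Ay * D z - A z * Dy = - (Bx * D z - B z * Dx)" "By * D z - B z * Dy = Ax * D z - A z * Dx"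
    using cr by (simp_all add: algebra_simps)
  then have e1: "(Ay * D z - A z * Dy) / (D z)\<^sup>2 = - v" and e2: "(By * D z - B z * Dy) / (D z)\<^sup>2 = u"
    unfolding u_def v_def by (simp_all only: minus_divide_left)
  have qa: "((\<lambda>w. A w / D w) has_derivative (\<lambda>h. u * Re h - v * Im h)) (at z)"
  proof -
    have "((\<lambda>w. A w / D w) has_derivative (\<lambda>h. u * Re h + (Ay * D z - A z * Dy) / (D z)\<^sup>2 * Im h)) (at z)"
      by (rule has_derivative_eq_rhs[OF has_derivative_divide'[OF A D nz]])
        (simp add: u_def fun_eq_iff power2_eq_square add_divide_distrib diff_divide_distrib algebra_simps)
    then show ?thesis unfolding e1 by simp
  qed
  have qb: "((\<lambda>w. B w / D w) has_derivative (\<lambda>h. v * Re h + u * Im h)) (at z)"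
  proof -
    have "((\<lambda>w. B w / D w) has_derivative (\<lambda>h. v * Re h + (By * D z - B z * Dy) / (D z)\<^sup>2 * Im h)) (at z)"
      by (rule has_derivative_eq_rhs[OF has_derivative_divide'[OF B D nz]])
        (simp add: v_def fun_eq_iff power2_eq_square add_divide_distrib diff_divide_distrib algebra_simps)
    then show ?thesis unfolding e2 by simp
  qed
  have "((\<lambda>w. of_real (A w / D w) + \<i> * of_real (B w / D w)) has_derivative
      (\<lambda>h. of_real (u * Re h - v * Im h) + \<i> * of_real (v * Re h + u * Im h))) (at z)"
    by (intro derivative_intros has_derivative_of_real qa qb)
  moreover have "of_real (u * Re h - v * Im h) + \<i> * of_real (v * Re h + u * Im h) = Complex u v * h" for h
    by (simp add: complex_eq_iff algebra_simps)
  moreover have "of_real (A w / D w) + \<i> * of_real (B w / D w) = Complex (A w) (B w) / of_real (D w)" for w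
    by (simp add: complex_eq_iff)
  ultimately show ?thesis
    unfolding field_differentiable_def has_field_derivative_def by auto
qed

text \<open>
  The addition theorem and Jacobi's imaginary transformation express \<open>sn, cn, dn\<close> at \<open>x + iy\<close> by the
  functions of modulus \<open>k\<close> at \<open>x\<close> (without index) and those of the complementary modulus at \<open>y\<close>
  (with index 1). Here these classical formulas define the complex functions. Their common
  denominator vanishes exactly at the poles, where division by 0 yields the value 0.
\<close>

definition jacobi_den where
  "jacobi_den k s s\<^sub>1 c\<^sub>1 (z::complex) = (c\<^sub>1 (Im z))\<^sup>2 + k\<^sup>2 * (s (Re z))\<^sup>2 * (s\<^sub>1 (Im z))\<^sup>2" for k :: real

definition complex_sn where
  "complex_sn k s c d s\<^sub>1 c\<^sub>1 d\<^sub>1 z =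
     Complex (s (Re z) * d\<^sub>1 (Im z)) (c (Re z) * d (Re z) * s\<^sub>1 (Im z) * c\<^sub>1 (Im z))
       / of_real (jacobi_den k s s\<^sub>1 c\<^sub>1 z)"

definition complex_cn where
  "complex_cn k s c d s\<^sub>1 c\<^sub>1 d\<^sub>1 z =
     Complex (c (Re z) * c\<^sub>1 (Im z)) (- s (Re z) * d (Re z) * s\<^sub>1 (Im z) * d\<^sub>1 (Im z))
       / of_real (jacobi_den k s s\<^sub>1 c\<^sub>1 z)"

definition complex_dn where
  "complex_dn k s c d s\<^sub>1 c\<^sub>1 d\<^sub>1 z =
     Complex (d (Re z) * c\<^sub>1 (Im z) * d\<^sub>1 (Im z)) (- k\<^sup>2 * s (Re z) * c (Re z) * s\<^sub>1 (Im z))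
       / of_real (jacobi_den k s s\<^sub>1 c\<^sub>1 z)"

lemma has_derivative_comp_Re:
  assumes "(f has_real_derivative f') (at (Re z))"
  shows "((\<lambda>w. f (Re w)) has_derivative (\<lambda>h. f' * Re h)) (at z)"
  using has_derivative_compose[of Re Re z UNIV f "(*) f'"] assms
  by (simp add: has_field_derivative_def bounded_linear_imp_has_derivative bounded_linear_Re)

lemma has_derivative_comp_Im:
  assumes "(f has_real_derivative f') (at (Im z))"
  shows "((\<lambda>w. f (Im w)) has_derivative (\<lambda>h. f' * Im h)) (at z)"
  using has_derivative_compose[of Im Im z UNIV f "(*) f'"] assms
  by (simp add: has_field_derivative_def bounded_linear_imp_has_derivative bounded_linear_Im)

text \<open>
  By \<open>quotient_field_differentiable\<close> this is a set of polynomial identities modulo the quadratic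
  relations between the six real functions.
\<close>

lemma complex_jacobi_field_differentiable:
  assumes t: "jacobi_triple k s c d" and t1: "jacobi_triple k' s\<^sub>1 c\<^sub>1 d\<^sub>1" and k: "k\<^sup>2 + k'\<^sup>2 = 1"
    and nz: "jacobi_den k s s\<^sub>1 c\<^sub>1 z \<noteq> 0"
  shows "complex_sn k s c d s\<^sub>1 c\<^sub>1 d\<^sub>1 field_differentiable (at z)"
    and "complex_cn k s c d s\<^sub>1 c\<^sub>1 d\<^sub>1 field_differentiable (at z)"
    and "complex_dn k s c d s\<^sub>1 c\<^sub>1 d\<^sub>1 field_differentiable (at z)"
proof -
  define x y where "x = Re z" and "y = Im z"
  note der = has_derivative_comp_Re[of s "c x * d x" z] has_derivative_comp_Re[of c "- s x * d x" z]
     has_derivative_comp_Re[of d "- k\<^sup>2 * s x * c x" z] has_derivative_comp_Im[of s\<^sub>1 "c\<^sub>1 y * d\<^sub>1 y" z]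
     has_derivative_comp_Im[of c\<^sub>1 "- s\<^sub>1 y * d\<^sub>1 y" z] has_derivative_comp_Im[of d\<^sub>1 "- k'\<^sup>2 * s\<^sub>1 y * c\<^sub>1 y" z]
  have D1: "((\<lambda>w. s (Re w)) has_derivative (\<lambda>h. c x * d x * Re h)) (at z)"
    "((\<lambda>w. c (Re w)) has_derivative (\<lambda>h. - s x * d x * Re h)) (at z)"
    "((\<lambda>w. d (Re w)) has_derivative (\<lambda>h. - k\<^sup>2 * s x * c x * Re h)) (at z)"
    "((\<lambda>w. s\<^sub>1 (Im w)) has_derivative (\<lambda>h. c\<^sub>1 y * d\<^sub>1 y * Im h)) (at z)"
    "((\<lambda>w. c\<^sub>1 (Im w)) has_derivative (\<lambda>h. - s\<^sub>1 y * d\<^sub>1 y * Im h)) (at z)"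
    "((\<lambda>w. d\<^sub>1 (Im w)) has_derivative (\<lambda>h. - k'\<^sup>2 * s\<^sub>1 y * c\<^sub>1 y * Im h)) (at z)"
    using der t t1 by (auto simp: jacobi_triple_def x_def y_def)
  have rel: "(s x)\<^sup>2 + (c x)\<^sup>2 = 1" "(d x)\<^sup>2 + k\<^sup>2 * (s x)\<^sup>2 = 1"
    "(s\<^sub>1 y)\<^sup>2 + (c\<^sub>1 y)\<^sup>2 = 1" "(d\<^sub>1 y)\<^sup>2 + k'\<^sup>2 * (s\<^sub>1 y)\<^sup>2 = 1"
    using t t1 by (auto simp: jacobi_triple_def)
  have dD: "(jacobi_den k s s\<^sub>1 c\<^sub>1 has_derivative
      (\<lambda>h. (2 * k\<^sup>2 * s x * c x * d x * (s\<^sub>1 y)\<^sup>2) * Re h +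
           (- 2 * s\<^sub>1 y * c\<^sub>1 y * d\<^sub>1 y + 2 * k\<^sup>2 * (s x)\<^sup>2 * s\<^sub>1 y * c\<^sub>1 y * d\<^sub>1 y) * Im h)) (at z)"
    unfolding jacobi_den_def[abs_def]
    by (rule derivative_eq_intros D1 refl)+
      (simp add: fun_eq_iff x_def y_def algebra_simps power2_eq_square)
  have dA: "((\<lambda>w. s (Re w) * d\<^sub>1 (Im w)) has_derivative
      (\<lambda>h. (c x * d x * d\<^sub>1 y) * Re h + (- k'\<^sup>2 * s x * s\<^sub>1 y * c\<^sub>1 y) * Im h)) (at z)"
    by (rule derivative_eq_intros D1 refl)+
      (simp add: fun_eq_iff x_def y_def algebra_simps power2_eq_square)
  have dB: "((\<lambda>w. c (Re w) * d (Re w) * s\<^sub>1 (Im w) * c\<^sub>1 (Im w)) has_derivative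
      (\<lambda>h. ((- s x * (d x)\<^sup>2 - k\<^sup>2 * s x * (c x)\<^sup>2) * s\<^sub>1 y * c\<^sub>1 y) * Re h +
           (c x * d x * ((c\<^sub>1 y)\<^sup>2 - (s\<^sub>1 y)\<^sup>2) * d\<^sub>1 y) * Im h)) (at z)"
    by (rule derivative_eq_intros D1 refl)+
      (simp add: fun_eq_iff x_def y_def algebra_simps power2_eq_square)
  have cA: "((\<lambda>w. c (Re w) * c\<^sub>1 (Im w)) has_derivative
      (\<lambda>h. (- s x * d x * c\<^sub>1 y) * Re h + (- c x * s\<^sub>1 y * d\<^sub>1 y) * Im h)) (at z)"
    by (rule derivative_eq_intros D1 refl)+
      (simp add: fun_eq_iff x_def y_def algebra_simps power2_eq_square)
  have cB: "((\<lambda>w. - s (Re w) * d (Re w) * s\<^sub>1 (Im w) * d\<^sub>1 (Im w)) has_derivative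
      (\<lambda>h. ((- c x * (d x)\<^sup>2 + k\<^sup>2 * (s x)\<^sup>2 * c x) * s\<^sub>1 y * d\<^sub>1 y) * Re h +
           (- s x * d x * (c\<^sub>1 y * (d\<^sub>1 y)\<^sup>2 - k'\<^sup>2 * (s\<^sub>1 y)\<^sup>2 * c\<^sub>1 y)) * Im h)) (at z)"
    by (rule derivative_eq_intros D1 refl)+
      (simp add: fun_eq_iff x_def y_def algebra_simps power2_eq_square)
  have eA: "((\<lambda>w. d (Re w) * c\<^sub>1 (Im w) * d\<^sub>1 (Im w)) has_derivative
      (\<lambda>h. (- k\<^sup>2 * s x * c x * c\<^sub>1 y * d\<^sub>1 y) * Re h +
           (d x * (- s\<^sub>1 y * (d\<^sub>1 y)\<^sup>2 - k'\<^sup>2 * s\<^sub>1 y * (c\<^sub>1 y)\<^sup>2)) * Im h)) (at z)"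
    by (rule derivative_eq_intros D1 refl)+
      (simp add: fun_eq_iff x_def y_def algebra_simps power2_eq_square)
  have eB: "((\<lambda>w. - k\<^sup>2 * s (Re w) * c (Re w) * s\<^sub>1 (Im w)) has_derivative
      (\<lambda>h. (- k\<^sup>2 * ((c x)\<^sup>2 - (s x)\<^sup>2) * d x * s\<^sub>1 y) * Re h +
           (- k\<^sup>2 * s x * c x * c\<^sub>1 y * d\<^sub>1 y) * Im h)) (at z)"
    by (rule derivative_eq_intros D1 refl)+
      (simp add: fun_eq_iff x_def y_def algebra_simps power2_eq_square)
  have Dz: "jacobi_den k s s\<^sub>1 c\<^sub>1 z = (c\<^sub>1 y)\<^sup>2 + k\<^sup>2 * (s x)\<^sup>2 * (s\<^sub>1 y)\<^sup>2"
    by (simp add: jacobi_den_def x_def y_def)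
  have rel': "(c x)\<^sup>2 = 1 - (s x)\<^sup>2" "(d x)\<^sup>2 = 1 - k\<^sup>2 * (s x)\<^sup>2"
    "(c\<^sub>1 y)\<^sup>2 = 1 - (s\<^sub>1 y)\<^sup>2" "(d\<^sub>1 y)\<^sup>2 = 1 - k'\<^sup>2 * (s\<^sub>1 y)\<^sup>2" "k'\<^sup>2 = 1 - k\<^sup>2"
    using rel k by auto
  show "complex_sn k s c d s\<^sub>1 c\<^sub>1 d\<^sub>1 field_differentiable (at z)"
    unfolding complex_sn_def[abs_def]
  proof (rule quotient_field_differentiable[OF dA dB dD nz], goal_cases)
    case 1 show ?case unfolding Dz x_def[symmetric] y_def[symmetric] using rel' by algebra
  next
    case 2 show ?case unfolding Dz x_def[symmetric] y_def[symmetric] using rel' by algebra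
  qed
  show "complex_cn k s c d s\<^sub>1 c\<^sub>1 d\<^sub>1 field_differentiable (at z)"
    unfolding complex_cn_def[abs_def]
  proof (rule quotient_field_differentiable[OF cA cB dD nz], goal_cases)
    case 1 show ?case unfolding Dz x_def[symmetric] y_def[symmetric] using rel' by algebra
  next
    case 2 show ?case unfolding Dz x_def[symmetric] y_def[symmetric] using rel' by algebra
  qed
  show "complex_dn k s c d s\<^sub>1 c\<^sub>1 d\<^sub>1 field_differentiable (at z)"
    unfolding complex_dn_def[abs_def]
  proof (rule quotient_field_differentiable[OF eA eB dD nz], goal_cases)
    case 1 show ?case unfolding Dz x_def[symmetric] y_def[symmetric] using rel' by algebra
  next
    case 2 show ?case unfolding Dz x_def[symmetric] y_def[symmetric] using rel' by algebra
  qed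
qed

section \<open>Uniqueness of meromorphic continuations and a criterion for poles\<close>

text \<open>
  The identity theorem makes the difference vanish near every point, up to the point itself; there,
  a nicely meromorphic function is determined by its values nearby.
\<close>

lemma nicely_meromorphic_eqI:
  assumes g: "g nicely_meromorphic_on UNIV" and h: "h nicely_meromorphic_on UNIV"
    and eq: "\<And>x::real. g (of_real x) = h (of_real x)"
  shows "g = h"
proof
  fix z
  define e where "e = (\<lambda>w. g w - h w)"
  have mero: "g meromorphic_on UNIV" "h meromorphic_on UNIV"
    using g h by (auto simp: nicely_meromorphic_on_def)
  have me: "e meromorphic_on A" for A
    unfolding e_def using mero meromorphic_on_subset[OF _ subset_UNIV] by (intro meromorphic_intros) auto
  have iso: "isolated_singularity_at e w" "not_essential e w" for w
    using me[of "{w}"] by (auto simp: meromorphic_at_iff)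
  have nice: "remove_sings e nicely_meromorphic_on UNIV"
    by (rule remove_sings_nicely_meromorphic[OF me])
  have "frequently (\<lambda>w. e w = 0) (at 0)"
    unfolding frequently_at
  proof (intro allI impI)
    fix r :: real assume "r > 0"
    then show "\<exists>w\<in>UNIV. w \<noteq> 0 \<and> dist w 0 < r \<and> e w = 0"
      by (intro bexI[of _ "of_real (r / 2)"]) (auto simp: e_def eq simp del: of_real_divide)
  qed
  moreover have "\<forall>\<^sub>F w in at 0. e w = 0 \<longrightarrow> remove_sings e w = 0"
    using eventually_remove_sings_eq_at[OF iso(1)[of 0]] by eventually_elim simp
  ultimately have "frequently (\<lambda>w. remove_sings e w = 0) (at 0)"
    by (rule frequently_rev_mp)
  from frequently_eq_meromorphic_imp_constant[OF this nice]
  have "remove_sings e w = 0" for w by auto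
  then have "eventually (\<lambda>w. e w = 0) (at z)"
    using eventually_remove_sings_eq_at[OF iso(1)[of z]] by (auto elim: eventually_mono)
  then have ev: "eventually (\<lambda>w. g w = h w) (at z)"
    by (auto simp: e_def)
  have "is_pole g z \<longleftrightarrow> is_pole h z"
    using ev by (rule is_pole_cong) auto
  moreover have "is_pole g z \<and> g z = 0 \<or> g \<midarrow>z\<rightarrow> g z" "is_pole h z \<and> h z = 0 \<or> h \<midarrow>z\<rightarrow> h z"
    using g h by (auto simp: nicely_meromorphic_on_def)
  moreover have "\<not> (is_pole f z \<and> f \<midarrow>z\<rightarrow> f z)" for f :: "complex \<Rightarrow> complex"
    using not_tendsto_and_filterlim_at_infinity[of "at z" f] by (auto simp: is_pole_def)
  moreover have "g \<midarrow>z\<rightarrow> g z \<Longrightarrow> h \<midarrow>z\<rightarrow> g z"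
    using tendsto_cong[OF ev] by auto
  ultimately show "g z = h z"
    by (metis LIM_unique)
qed

lemma mero_continuation_eqI:
  assumes "g nicely_meromorphic_on UNIV" "\<And>x. g (of_real x) = of_real (f x)"
  shows "mero_continuation f = g"
  unfolding mero_continuation_def
  using assms by (intro the_equality) (auto intro!: nicely_meromorphic_eqI)

text \<open>
  The equation \<open>f h = g\<close> with \<open>g z \<noteq> 0\<close> forces \<open>h \<noteq> 0\<close> near \<open>z\<close>, hence \<open>f = g / h\<close> there.
\<close>

lemma meromorphic_pole_of_quotient:
  assumes g: "g analytic_on {z}" "g z \<noteq> 0" and h: "h analytic_on {z}" "h z = 0"
    and eq: "\<forall>\<^sub>F w in at z. f w * h w = g w"
  shows "f meromorphic_on {z}" "is_pole f z"
proof -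
  have ct: "g \<midarrow>z\<rightarrow> g z" "h \<midarrow>z\<rightarrow> 0"
    using analytic_at_imp_isCont g h by (metis isContD)+
  have "\<forall>\<^sub>F w in at z. g w \<noteq> 0"
    using ct(1) g(2) by (rule tendsto_imp_eventually_ne)
  with eq have ev: "\<forall>\<^sub>F w in at z. h w \<noteq> 0 \<and> f w = g w / h w"
    by eventually_elim (metis mult_eq_0_iff nonzero_eq_divide_eq)
  have "filterlim h (at 0) (at z)"
    using ct ev by (auto simp: filterlim_at elim: eventually_mono)
  then have "is_pole (\<lambda>w. g w / h w) z"
    unfolding is_pole_def using ct g(2) by (intro filterlim_divide_at_infinity) auto
  moreover have c: "is_pole f z \<longleftrightarrow> is_pole (\<lambda>w. g w / h w) z"
    using ev by (intro is_pole_cong) (auto elim: eventually_mono)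
  ultimately show "is_pole f z" by simp
  have "(\<lambda>w. g w / h w) meromorphic_on {z}"
    using g h by (intro meromorphic_intros analytic_on_imp_meromorphic_on)
  moreover have "f meromorphic_on {z} \<longleftrightarrow> (\<lambda>w. g w / h w) meromorphic_on {z}"
    using ev by (intro meromorphic_on_cong) (auto elim: eventually_mono)
  ultimately show "f meromorphic_on {z}" by simp
qed

section \<open>Meromorphy of the complex Jacobi functions\<close>

lemma eventually_at_nonzero_derivative:
  fixes f :: "real \<Rightarrow> real"
  assumes "(f has_real_derivative l) (at x)" "l \<noteq> 0"
  shows "\<forall>\<^sub>F y in at x. f y \<noteq> f x"
proof -
  have "\<forall>\<^sub>F y in at x. (f y - f x) / (y - x) \<noteq> 0"
    using assms by (intro tendsto_imp_eventually_ne) (auto simp: has_field_derivative_iff)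
  then show ?thesis by eventually_elim auto
qed

locale jacobi_extension =
  fixes k k' :: real and s c d s\<^sub>1 c\<^sub>1 d\<^sub>1 :: "real \<Rightarrow> real"
  assumes triple: "jacobi_triple k s c d" and triple1: "jacobi_triple k' s\<^sub>1 c\<^sub>1 d\<^sub>1"
    and k_pos: "k > 0" and complementary: "k\<^sup>2 + k'\<^sup>2 = 1"
begin

text \<open>
  Index 2 denotes the translates of the functions with index 1 by a quarter period. The complex
  functions built from them are \<open>sn, cn, dn\<close> translated by \<open>iK'\<close>.
\<close>

definition s\<^sub>2 where "s\<^sub>2 = (\<lambda>y. c\<^sub>1 y / d\<^sub>1 y)"
definition c\<^sub>2 where "c\<^sub>2 = (\<lambda>y. - k * s\<^sub>1 y / d\<^sub>1 y)"
definition d\<^sub>2 where "d\<^sub>2 = (\<lambda>y. k / d\<^sub>1 y)"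

abbreviation "D \<equiv> jacobi_den k s s\<^sub>1 c\<^sub>1"
abbreviation "SN \<equiv> complex_sn k s c d s\<^sub>1 c\<^sub>1 d\<^sub>1"
abbreviation "CN \<equiv> complex_cn k s c d s\<^sub>1 c\<^sub>1 d\<^sub>1"
abbreviation "DN \<equiv> complex_dn k s c d s\<^sub>1 c\<^sub>1 d\<^sub>1"
abbreviation "D2 \<equiv> jacobi_den k s s\<^sub>2 c\<^sub>2"
abbreviation "SN2 \<equiv> complex_sn k s c d s\<^sub>2 c\<^sub>2 d\<^sub>2"
abbreviation "CN2 \<equiv> complex_cn k s c d s\<^sub>2 c\<^sub>2 d\<^sub>2"
abbreviation "DN2 \<equiv> complex_dn k s c d s\<^sub>2 c\<^sub>2 d\<^sub>2"

lemma triple2: "jacobi_triple k' s\<^sub>2 c\<^sub>2 d\<^sub>2"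
  unfolding s\<^sub>2_def c\<^sub>2_def d\<^sub>2_def
  by (rule jacobi_triple_quarter_shift[OF triple1 k_pos complementary])

lemma relations:
  "(s x)\<^sup>2 + (c x)\<^sup>2 = 1" "(d x)\<^sup>2 + k\<^sup>2 * (s x)\<^sup>2 = 1"
  "(s\<^sub>1 y)\<^sup>2 + (c\<^sub>1 y)\<^sup>2 = 1" "(d\<^sub>1 y)\<^sup>2 + k'\<^sup>2 * (s\<^sub>1 y)\<^sup>2 = 1"
  using triple triple1 by (auto simp: jacobi_triple_def)

lemma derivatives:
  "(s has_real_derivative c x * d x) (at x)"
  "(s\<^sub>1 has_real_derivative c\<^sub>1 y * d\<^sub>1 y) (at y)"
  "(c\<^sub>1 has_real_derivative - s\<^sub>1 y * d\<^sub>1 y) (at y)"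
  using triple triple1 by (simp_all add: jacobi_triple_def)

lemma d1_nonzero: "d\<^sub>1 y \<noteq> 0"
  by (rule jacobi_triple_dn_nonzero[OF triple1 k_pos complementary])

lemma den_eq_0_iff: "D z = 0 \<longleftrightarrow> s (Re z) = 0 \<and> c\<^sub>1 (Im z) = 0"
proof
  assume "D z = 0"
  then have "(c\<^sub>1 (Im z))\<^sup>2 + (k * s (Re z) * s\<^sub>1 (Im z))\<^sup>2 = 0"
    by (simp add: jacobi_den_def power_mult_distrib)
  then have *: "c\<^sub>1 (Im z) = 0" "k * s (Re z) * s\<^sub>1 (Im z) = 0"
    by (simp_all only: sum_power2_eq_zero_iff)
  moreover have "s\<^sub>1 (Im z) \<noteq> 0" using relations(3)[of "Im z"] * by auto
  ultimately show "s (Re z) = 0 \<and> c\<^sub>1 (Im z) = 0" using k_pos by auto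
qed (simp add: jacobi_den_def)

lemma den2_eq: "D2 z = k\<^sup>2 * ((s\<^sub>1 (Im z))\<^sup>2 + (s (Re z))\<^sup>2 * (c\<^sub>1 (Im z))\<^sup>2) / (d\<^sub>1 (Im z))\<^sup>2"
  using d1_nonzero[of "Im z"]
  by (simp add: jacobi_den_def c\<^sub>2_def s\<^sub>2_def power_mult_distrib power_divide field_simps)

lemma den2_nonzero: "D z = 0 \<Longrightarrow> D2 z \<noteq> 0"
  using relations(3)[of "Im z"] k_pos d1_nonzero[of "Im z"] by (auto simp: den2_eq den_eq_0_iff)

text \<open>
  The denominator vanishes only where \<open>s\<close> and \<open>c\<^sub>1\<close> both do, and these have simple zeros.
\<close>

lemma isolated_den_zero:
  assumes "D z = 0"
  shows "\<forall>\<^sub>F w in at z. D w \<noteq> 0"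
proof -
  define x y where "x = Re z" and "y = Im z"
  have 0: "s x = 0" "c\<^sub>1 y = 0" using assms by (auto simp: den_eq_0_iff x_def y_def)
  have "(s has_real_derivative c x * d x) (at x)" "c x * d x \<noteq> 0"
    using derivatives(1)[of x] relations(1,2)[of x] 0 by auto
  from eventually_at_nonzero_derivative[OF this] obtain e1
    where e1: "e1 > 0" "\<And>u. u \<noteq> x \<Longrightarrow> \<bar>u - x\<bar> < e1 \<Longrightarrow> s u \<noteq> 0"
    using 0 by (auto simp: eventually_at dist_real_def)
  have "(c\<^sub>1 has_real_derivative - s\<^sub>1 y * d\<^sub>1 y) (at y)" "- s\<^sub>1 y * d\<^sub>1 y \<noteq> 0"
    using derivatives(3)[of y] relations(3)[of y] d1_nonzero[of y] 0 by auto
  from eventually_at_nonzero_derivative[OF this] obtain e2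
    where e2: "e2 > 0" "\<And>u. u \<noteq> y \<Longrightarrow> \<bar>u - y\<bar> < e2 \<Longrightarrow> c\<^sub>1 u \<noteq> 0"
    using 0 by (auto simp: eventually_at dist_real_def)
  show ?thesis
    unfolding eventually_at
  proof (intro exI[of _ "min e1 e2"] conjI ballI impI)
    fix w assume w: "w \<noteq> z \<and> dist w z < min e1 e2"
    have "\<bar>Re w - x\<bar> \<le> dist w z" "\<bar>Im w - y\<bar> \<le> dist w z"
      using abs_Re_le_cmod[of "w - z"] abs_Im_le_cmod[of "w - z"] by (auto simp: dist_norm x_def y_def)
    then show "D w \<noteq> 0"
      using w e1(2)[of "Re w"] e2(2)[of "Im w"] complex_eqI[of w z]
      by (auto simp: den_eq_0_iff x_def y_def)
  qed (use e1 e2 in auto)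
qed

lemma continuous_den: "continuous_on UNIV D"
proof -
  have "isCont s x" "isCont s\<^sub>1 x" "isCont c\<^sub>1 x" for x
    using derivatives DERIV_isCont by blast+
  then have "isCont (\<lambda>z. s (Re z)) z" "isCont (\<lambda>z. s\<^sub>1 (Im z)) z" "isCont (\<lambda>z. c\<^sub>1 (Im z)) z" for z
    by (auto intro!: isCont_o2[OF isCont_Re[OF continuous_ident]] isCont_o2[OF isCont_Im[OF continuous_ident]])
  then show ?thesis
    unfolding jacobi_den_def[abs_def] by (intro continuous_at_imp_continuous_on ballI continuous_intros)
qed

lemma analytic_off_den_zeros:
  assumes "D z \<noteq> 0"
  shows "SN analytic_on {z}" "CN analytic_on {z}" "DN analytic_on {z}"
proof -
  have "open {w. D w \<noteq> 0}" using continuous_den by (simp add: open_Collect_neq)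
  moreover have "SN holomorphic_on {w. D w \<noteq> 0}" "CN holomorphic_on {w. D w \<noteq> 0}" "DN holomorphic_on {w. D w \<noteq> 0}"
    using complex_jacobi_field_differentiable[OF triple triple1 complementary]
    by (auto simp: holomorphic_on_def intro: field_differentiable_at_within)
  ultimately show "SN analytic_on {z}" "CN analytic_on {z}" "DN analytic_on {z}"
    using assms by (auto intro: holomorphic_on_imp_analytic_at)
qed

text \<open>
  These are \<open>k sn(z) sn(z + iK') = 1\<close>, \<open>cn(z) = i dn(z + iK') / (k sn(z + iK'))\<close> and
  \<open>dn(z) = i cn(z + iK') / sn(z + iK')\<close>. They present each function as a quotient of translated
  functions, which are analytic at the points where the original has a vanishing denominator.
\<close>

lemma quarter_period_relations:
  assumes D: "D z \<noteq> 0" and D2: "D2 z \<noteq> 0"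
  shows "SN z * (of_real k * SN2 z) = 1"
    and "CN z * (of_real k * SN2 z) = \<i> * DN2 z"
    and "DN z * SN2 z = \<i> * CN2 z"
proof -
  define x y where "x = Re z" and "y = Im z"
  define E where "E = (s\<^sub>1 y)\<^sup>2 + (s x)\<^sup>2 * (c\<^sub>1 y)\<^sup>2"
  have nz: "k \<noteq> 0" "d\<^sub>1 y \<noteq> 0" using k_pos d1_nonzero by auto
  have E: "E \<noteq> 0" using D2 by (auto simp: den2_eq E_def x_def y_def)
  have den2: "D2 z = k\<^sup>2 * E / (d\<^sub>1 y)\<^sup>2" by (simp add: den2_eq E_def x_def y_def)
  have Dz: "D z = (c\<^sub>1 y)\<^sup>2 + k\<^sup>2 * (s x)\<^sup>2 * (s\<^sub>1 y)\<^sup>2" by (simp add: jacobi_den_def x_def y_def)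
  have rel: "(c x)\<^sup>2 = 1 - (s x)\<^sup>2" "(d x)\<^sup>2 = 1 - k\<^sup>2 * (s x)\<^sup>2" "(c\<^sub>1 y)\<^sup>2 = 1 - (s\<^sub>1 y)\<^sup>2"
     "(d\<^sub>1 y)\<^sup>2 = 1 - k'\<^sup>2 * (s\<^sub>1 y)\<^sup>2" "k'\<^sup>2 = 1 - k\<^sup>2"
    using relations(1,2)[of x] relations(3,4)[of y] complementary by auto
  have S: "of_real k * SN2 z = Complex (s x * d\<^sub>1 y) (- c x * d x * s\<^sub>1 y * c\<^sub>1 y) / of_real E"
    unfolding complex_sn_def den2 x_def[symmetric] y_def[symmetric]
    using nz E by (simp add: s\<^sub>2_def c\<^sub>2_def d\<^sub>2_def
        complex_eq_iff field_simps power2_eq_square)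
  have C: "CN2 z = Complex (- c x * s\<^sub>1 y * d\<^sub>1 y) (- s x * d x * c\<^sub>1 y) / of_real (k * E)"
    unfolding complex_cn_def den2 x_def[symmetric] y_def[symmetric]
    using nz E by (simp add: s\<^sub>2_def c\<^sub>2_def d\<^sub>2_def
        complex_eq_iff field_simps power2_eq_square)
  have DD: "DN2 z = Complex (- d x * s\<^sub>1 y) (- s x * c x * c\<^sub>1 y * d\<^sub>1 y) / of_real E"
    unfolding complex_dn_def den2 x_def[symmetric] y_def[symmetric]
    using nz E by (simp add: s\<^sub>2_def c\<^sub>2_def d\<^sub>2_def
        complex_eq_iff field_simps power2_eq_square)
  have S': "SN2 z = Complex (s x * d\<^sub>1 y) (- c x * d x * s\<^sub>1 y * c\<^sub>1 y) / of_real (k * E)"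
    using arg_cong[OF S, of "\<lambda>w. w / of_real k"] nz by (simp add: mult.commute)
  have *: "Complex a b / of_real u * (Complex a' b' / of_real v) =
           Complex (a * a' - b * b') (a * b' + b * a') / of_real (u * v)" for a b a' b' u v
    by (simp add: complex_eq_iff times_divide_times_eq flip: of_real_mult)
  have cancel: "Complex (p * u) (q * u) / of_real (u * v) = Complex p q / of_real v" if "u \<noteq> 0" for p q u v
    using that by (simp add: complex_eq_iff flip: of_real_mult)
  show "SN z * (of_real k * SN2 z) = 1"
  proof -
    have p: "(s x * d\<^sub>1 y) * (s x * d\<^sub>1 y) - (c x * d x * s\<^sub>1 y * c\<^sub>1 y) * (- c x * d x * s\<^sub>1 y * c\<^sub>1 y) = E * D z"
      "(s x * d\<^sub>1 y) * (- c x * d x * s\<^sub>1 y * c\<^sub>1 y) + (c x * d x * s\<^sub>1 y * c\<^sub>1 y) * (s x * d\<^sub>1 y) = 0 * D z"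
      unfolding E_def Dz using rel by (algebra, simp)
    have "SN z * (of_real k * SN2 z) = Complex (E * D z) (0 * D z) / of_real (D z * E)"
      unfolding S complex_sn_def[of k s c d s\<^sub>1 c\<^sub>1 d\<^sub>1] x_def[symmetric] y_def[symmetric] *
      by (simp only: p)
    also have "\<dots> = Complex E 0 / of_real E" using D by (rule cancel)
    also have "\<dots> = 1" using E by (simp add: complex_eq_iff)
    finally show ?thesis .
  qed
  show "CN z * (of_real k * SN2 z) = \<i> * DN2 z"
  proof -
    have p: "(c x * c\<^sub>1 y) * (s x * d\<^sub>1 y) - (- s x * d x * s\<^sub>1 y * d\<^sub>1 y) * (- c x * d x * s\<^sub>1 y * c\<^sub>1 y) = (s x * c x * c\<^sub>1 y * d\<^sub>1 y) * D z"
      "(c x * c\<^sub>1 y) * (- c x * d x * s\<^sub>1 y * c\<^sub>1 y) + (- s x * d x * s\<^sub>1 y * d\<^sub>1 y) * (s x * d\<^sub>1 y) = (- d x * s\<^sub>1 y) * D z"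
      unfolding E_def Dz using rel by algebra+
    have "CN z * (of_real k * SN2 z) =
        Complex ((s x * c x * c\<^sub>1 y * d\<^sub>1 y) * D z) ((- d x * s\<^sub>1 y) * D z) / of_real (D z * E)"
      unfolding S complex_cn_def[of k s c d s\<^sub>1 c\<^sub>1 d\<^sub>1] x_def[symmetric] y_def[symmetric] *
      by (simp only: p)
    also have "\<dots> = Complex (s x * c x * c\<^sub>1 y * d\<^sub>1 y) (- d x * s\<^sub>1 y) / of_real E" using D by (rule cancel)
    also have "\<dots> = \<i> * DN2 z" unfolding DD by (simp add: complex_eq_iff)
    finally show ?thesis .
  qed
  show "DN z * SN2 z = \<i> * CN2 z"
  proof -
    have p: "(d x * c\<^sub>1 y * d\<^sub>1 y) * (s x * d\<^sub>1 y) - (- k\<^sup>2 * s x * c x * s\<^sub>1 y) * (- c x * d x * s\<^sub>1 y * c\<^sub>1 y) = (s x * d x * c\<^sub>1 y) * D z"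
      "(d x * c\<^sub>1 y * d\<^sub>1 y) * (- c x * d x * s\<^sub>1 y * c\<^sub>1 y) + (- k\<^sup>2 * s x * c x * s\<^sub>1 y) * (s x * d\<^sub>1 y) = (- c x * s\<^sub>1 y * d\<^sub>1 y) * D z"
      unfolding E_def Dz using rel by algebra+
    have "DN z * SN2 z =
        Complex ((s x * d x * c\<^sub>1 y) * D z) ((- c x * s\<^sub>1 y * d\<^sub>1 y) * D z) / of_real (D z * (k * E))"
      unfolding S' complex_dn_def[of k s c d s\<^sub>1 c\<^sub>1 d\<^sub>1] x_def[symmetric] y_def[symmetric] *
      by (simp only: p)
    also have "\<dots> = Complex (s x * d x * c\<^sub>1 y) (- c x * s\<^sub>1 y * d\<^sub>1 y) / of_real (k * E)" using D by (rule cancel)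
    also have "\<dots> = \<i> * CN2 z" unfolding C by (simp add: complex_eq_iff)
    finally show ?thesis .
  qed
qed

lemma shifted: "jacobi_extension k k' s c d s\<^sub>2 c\<^sub>2 d\<^sub>2"
  using triple triple2 k_pos complementary by unfold_locales

lemma pole_at_den_zeros:
  assumes "D z = 0"
  shows "SN meromorphic_on {z}" "is_pole SN z" "CN meromorphic_on {z}" "is_pole CN z"
    "DN meromorphic_on {z}" "is_pole DN z"
proof -
  have D2: "D2 z \<noteq> 0" using assms by (rule den2_nonzero)
  note an = jacobi_extension.analytic_off_den_zeros[OF shifted D2]
  have "\<forall>\<^sub>F w in at z. D2 w \<noteq> 0"
    using jacobi_extension.continuous_den[OF shifted] D2
    by (intro tendsto_imp_eventually_ne[where c = "D2 z"]) (auto simp: continuous_on_def)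
  with isolated_den_zero[OF assms] have ev: "\<forall>\<^sub>F w in at z. D w \<noteq> 0 \<and> D2 w \<noteq> 0"
    by eventually_elim auto
  have 0: "s (Re z) = 0" "c\<^sub>1 (Im z) = 0" using assms by (auto simp: den_eq_0_iff)
  have nz: "s\<^sub>1 (Im z) \<noteq> 0" "c (Re z) \<noteq> 0" "d (Re z) \<noteq> 0"
    using relations(1,2)[of "Re z"] relations(3)[of "Im z"] 0 by auto
  have v: "SN2 z = 0" "CN2 z \<noteq> 0" "DN2 z \<noteq> 0"
    using 0 nz D2 d1_nonzero[of "Im z"] k_pos
    by (auto simp: complex_sn_def complex_cn_def complex_dn_def s\<^sub>2_def c\<^sub>2_def d\<^sub>2_def complex_eq_iff)
  show "SN meromorphic_on {z}" "is_pole SN z"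
    by (rule meromorphic_pole_of_quotient[where g = "\<lambda>_. 1" and h = "\<lambda>w. of_real k * SN2 w"];
        use an v ev quarter_period_relations in \<open>auto intro!: analytic_intros elim!: eventually_mono\<close>)+
  show "CN meromorphic_on {z}" "is_pole CN z"
    by (rule meromorphic_pole_of_quotient[where g = "\<lambda>w. \<i> * DN2 w" and h = "\<lambda>w. of_real k * SN2 w"];
        use an v ev quarter_period_relations in \<open>auto intro!: analytic_intros elim!: eventually_mono\<close>)+
  show "DN meromorphic_on {z}" "is_pole DN z"
    by (rule meromorphic_pole_of_quotient[where g = "\<lambda>w. \<i> * CN2 w" and h = "SN2"];
        use an v ev quarter_period_relations in \<open>auto intro!: analytic_intros elim!: eventually_mono\<close>)+
qed

lemma nicely_meromorphic:
  "SN nicely_meromorphic_on UNIV" "CN nicely_meromorphic_on UNIV" "DN nicely_meromorphic_on UNIV"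
proof -
  have *: "f nicely_meromorphic_on UNIV"
    if "\<And>z. D z \<noteq> 0 \<Longrightarrow> f analytic_on {z}" "\<And>z. D z = 0 \<Longrightarrow> f meromorphic_on {z}"
      "\<And>z. D z = 0 \<Longrightarrow> is_pole f z" "\<And>z. D z = 0 \<Longrightarrow> f z = 0" for f
    unfolding nicely_meromorphic_on_def
  proof (intro conjI ballI)
    show "f meromorphic_on UNIV"
      by (subst meromorphic_on_meromorphic_at) (use that analytic_on_imp_meromorphic_on in blast)
    show "is_pole f z \<and> f z = 0 \<or> f \<midarrow>z\<rightarrow> f z" for z
      using that analytic_at_imp_isCont[of f z] by (auto simp: isCont_def)
  qed
  show "SN nicely_meromorphic_on UNIV" "CN nicely_meromorphic_on UNIV" "DN nicely_meromorphic_on UNIV"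
    by (rule *; use analytic_off_den_zeros pole_at_den_zeros in \<open>auto simp: complex_sn_def complex_cn_def complex_dn_def\<close>)+
qed

end

section \<open>The real amplitude and the complete integrals\<close>

definition legendre_delta :: "real \<Rightarrow> real \<Rightarrow> real" where
  "legendre_delta q \<phi> = sqrt (1 - q\<^sup>2 * (sin \<phi>)\<^sup>2)"

text \<open>
  The angles in the domain of the amplitude's inverse: for \<open>q = 1\<close> the integrand has a
  nonintegrable singularity at \<open>\<plusminus>\<pi>/2\<close>.
\<close>

definition am_range :: "real \<Rightarrow> real set" where
  "am_range q = {\<phi>. q = 1 \<longrightarrow> \<bar>\<phi>\<bar> < pi / 2}"

lemma am_range_interval: "\<phi> \<in> am_range q \<Longrightarrow> \<bar>\<psi>\<bar> \<le> \<bar>\<phi>\<bar> \<Longrightarrow> \<psi> \<in> am_range q"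
  by (auto simp: am_range_def)

lemma zero_in_am_range: "0 \<in> am_range q"
  by (auto simp: am_range_def)

lemma open_am_range: "open (am_range q)"
proof (cases "q = 1")
  case True
  then have "am_range q = {-pi/2<..<pi/2}" by (auto simp: am_range_def)
  then show ?thesis by simp
qed (simp add: am_range_def)

context
  fixes q :: real
  assumes q: "0 \<le> q" "q \<le> 1"
begin

lemma modular_pos:
  assumes "\<phi> \<in> am_range q"
  shows "q\<^sup>2 * (sin \<phi>)\<^sup>2 < 1"
proof (cases "q = 1")
  case True
  then have "cos \<phi> > 0" using assms by (intro cos_gt_zero_pi) (auto simp: am_range_def)
  then have "(cos \<phi>)\<^sup>2 > 0" by simp
  then show ?thesis unfolding True sin_squared_eq by simp
next
  case False
  have "q\<^sup>2 < 1" using q False by (auto simp: power_less_one_iff abs_square_less_1)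
  moreover have "(sin \<phi>)\<^sup>2 \<le> 1" by (simp add: abs_square_le_1)
  ultimately have "q\<^sup>2 * (sin \<phi>)\<^sup>2 \<le> q\<^sup>2 * 1" by (intro mult_left_mono) auto
  with \<open>q\<^sup>2 < 1\<close> show ?thesis by simp
qed

lemma legendre_delta_pos: "\<phi> \<in> am_range q \<Longrightarrow> legendre_delta q \<phi> > 0"
  using modular_pos by (simp add: legendre_delta_def)

lemma legendre_delta_sq: "\<phi> \<in> am_range q \<Longrightarrow> (legendre_delta q \<phi>)\<^sup>2 = 1 - q\<^sup>2 * (sin \<phi>)\<^sup>2"
  using modular_pos[of \<phi>] by (simp add: legendre_delta_def)

lemma elliptic_F_0: "elliptic_F q 0 = 0"
  by (simp add: elliptic_F_def zero_ereal_def)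

lemma elliptic_F_deriv:
  assumes "\<phi> \<in> am_range q"
  shows "(elliptic_F q has_real_derivative 1 / legendre_delta q \<phi>) (at \<phi>)"
proof -
  define m where "m = (if q = 1 then (\<bar>\<phi>\<bar> + pi / 2) / 2 else \<bar>\<phi>\<bar> + 1)"
  have m: "m > \<bar>\<phi>\<bar>" "m \<in> am_range q"
    using assms by (auto simp: m_def am_range_def)
  then have "\<bar>m\<bar> = m" by simp
  have "continuous_on {-m..m} (\<lambda>\<theta>. 1 / legendre_delta q \<theta>)"
  proof -
    have "legendre_delta q \<theta> \<noteq> 0" if "\<theta> \<in> {-m..m}" for \<theta>
      using legendre_delta_pos[OF am_range_interval[OF m(2), of \<theta>]] that \<open>\<bar>m\<bar> = m\<close> by (auto simp: abs_le_iff)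
    then show ?thesis unfolding legendre_delta_def by (intro continuous_intros) auto
  qed
  then have "((\<lambda>u. LBINT y=ereal 0..u. 1 / legendre_delta q y) has_vector_derivative 1 / legendre_delta q \<phi>)
      (at \<phi> within {-m..m})"
    using m by (intro interval_integral_FTC2) auto
  then have "(elliptic_F q has_vector_derivative 1 / legendre_delta q \<phi>) (at \<phi> within {-m..m})"
    by (simp add: elliptic_F_def[abs_def] legendre_delta_def zero_ereal_def)
  moreover have "at \<phi> within {-m..m} = at \<phi>"
    using m by (intro at_within_Icc_at) auto
  ultimately show ?thesis by (simp add: has_real_derivative_iff_has_vector_derivative)
qed

lemma elliptic_F_less:
  assumes "\<phi> < \<psi>" "\<phi> \<in> am_range q" "\<psi> \<in> am_range q"
  shows "elliptic_F q \<phi> < elliptic_F q \<psi>"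
proof (rule DERIV_pos_imp_increasing[OF assms(1)])
  fix x assume "\<phi> \<le> x" "x \<le> \<psi>"
  then have "x \<in> am_range q" using assms by (auto simp: am_range_def)
  then show "\<exists>y. (elliptic_F q has_real_derivative y) (at x) \<and> 0 < y"
    using elliptic_F_deriv legendre_delta_pos by (intro exI[of _ "1 / legendre_delta q x"]) auto
qed

text \<open>
  For \<open>q < 1\<close> the integrand is at least 1, so the absolute value of the integral is at least \<open>\<bar>\<phi>\<bar>\<close>
  and every real value is taken. For \<open>q = 1\<close> it is the inverse Gudermannian function \<open>artanh (sin \<phi>)\<close>.
\<close>

lemma elliptic_F_surj: "\<exists>\<phi>\<in>am_range q. elliptic_F q \<phi> = u"
proof (cases "q = 1")
  case True
  have tanh: "\<bar>tanh u\<bar> < 1" using tanh_real_lt_1[of u] tanh_real_gt_neg1[of u] by auto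
  define \<phi> where "\<phi> = arcsin (tanh u)"
  have \<phi>: "\<bar>\<phi>\<bar> < pi / 2" using tanh arcsin_lt_bounded[of "tanh u"] unfolding \<phi>_def abs_less_iff by linarith
  have \<phi>_range: "\<phi> \<in> am_range q" using \<phi> by (simp add: am_range_def)
  have I: "am_range q = {-pi/2<..<pi/2}" using True by (auto simp: am_range_def)
  have "\<exists>C. \<forall>x\<in>am_range q. elliptic_F q x - artanh (sin x) = C"
  proof (rule has_field_derivative_zero_constant)
    show "convex (am_range q)" by (simp add: I)
    have d: "((\<lambda>x. elliptic_F q x - artanh (sin x)) has_real_derivative 0) (at x)" if "x \<in> am_range q" for x
    proof -
      have c: "cos x > 0" using that True by (intro cos_gt_zero_pi) (auto simp: am_range_def)
      have "(sin x)\<^sup>2 < 1" using modular_pos[OF that] True by simp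
      then have s: "\<bar>sin x\<bar> < 1" by (simp add: abs_square_less_1)
      have "legendre_delta q x = cos x" using c True by (simp add: legendre_delta_def cos_squared_eq[symmetric])
      then have D: "(elliptic_F q has_real_derivative 1 / cos x) (at x)" using elliptic_F_deriv[OF that] by simp
      have "cos x / (1 - (sin x)\<^sup>2) = 1 / cos x"
        unfolding cos_squared_eq[symmetric] using c by (simp add: power2_eq_square)
      moreover have "((\<lambda>x. artanh (sin x)) has_real_derivative 1 / (1 - (sin x)\<^sup>2) * cos x) (at x)"
        using s by (intro DERIV_chain2[of artanh] artanh_real_has_field_derivative DERIV_sin)
      ultimately show ?thesis
        using DERIV_diff[OF D] by fastforce
    qed
    then show "((\<lambda>x. elliptic_F q x - artanh (sin x)) has_real_derivative 0) (at x within am_range q)"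
      if "x \<in> am_range q" for x using that by (blast intro: has_field_derivative_at_within)
  qed
  then have "elliptic_F q \<phi> - artanh (sin \<phi>) = elliptic_F q 0 - artanh (sin 0)"
    using \<phi>_range zero_in_am_range[of q] by metis
  then have "elliptic_F q \<phi> = u"
    using tanh by (simp add: elliptic_F_0 \<phi>_def artanh_tanh_real)
  then show ?thesis using \<phi> by (auto simp: am_range_def)
next
  case False
  then have all: "x \<in> am_range q" for x by (simp add: am_range_def)
  have mono: "elliptic_F q x - x \<le> elliptic_F q y - y" if "x \<le> y" for x y
  proof (rule DERIV_nonneg_imp_nondecreasing[OF that])
    fix z
    have "legendre_delta q z \<le> 1" by (simp add: legendre_delta_def)
    then have "1 / legendre_delta q z \<ge> 1" using legendre_delta_pos[OF all] by simp
    then show "\<exists>w. ((\<lambda>x. elliptic_F q x - x) has_real_derivative w) (at z) \<and> 0 \<le> w"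
      using elliptic_F_deriv[OF all, of z] by (intro exI[of _ "1 / legendre_delta q z - 1"]) (auto intro!: derivative_intros)
  qed
  have "elliptic_F q (- \<bar>u\<bar>) \<le> u" "u \<le> elliptic_F q \<bar>u\<bar>"
    using mono[of "- \<bar>u\<bar>" 0] mono[of 0 "\<bar>u\<bar>"] elliptic_F_0 by auto
  then have "\<exists>\<phi>\<ge>- \<bar>u\<bar>. \<phi> \<le> \<bar>u\<bar> \<and> elliptic_F q \<phi> = u"
    using elliptic_F_deriv[OF all] by (intro IVT) (auto intro: DERIV_isCont)
  then show ?thesis using all by auto
qed

lemma elliptic_F_eq_iff:
  "\<phi> \<in> am_range q \<Longrightarrow> \<psi> \<in> am_range q \<Longrightarrow> elliptic_F q \<phi> = elliptic_F q \<psi> \<longleftrightarrow> \<phi> = \<psi>"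
  using elliptic_F_less by (metis less_irrefl linorder_less_linear)

lemma jacobi_am_elliptic_F: "\<phi> \<in> am_range q \<Longrightarrow> jacobi_am q (elliptic_F q \<phi>) = \<phi>"
  unfolding jacobi_am_def
  by (rule the_equality) (auto simp: am_range_def[of q] elliptic_F_eq_iff[unfolded am_range_def])

lemma jacobi_am: "jacobi_am q u \<in> am_range q" "elliptic_F q (jacobi_am q u) = u"
  using elliptic_F_surj[of u] jacobi_am_elliptic_F by auto

lemma jacobi_am_0: "jacobi_am q 0 = 0"
  using jacobi_am_elliptic_F[OF zero_in_am_range] elliptic_F_0 by simp

lemma jacobi_am_less_iff: "jacobi_am q u < jacobi_am q v \<longleftrightarrow> u < v"
  using elliptic_F_less jacobi_am by (metis less_asym linorder_less_linear)

lemma jacobi_am_deriv: "(jacobi_am q has_real_derivative legendre_delta q (jacobi_am q u)) (at u)"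
proof -
  have "(jacobi_am q has_real_derivative inverse (1 / legendre_delta q (jacobi_am q u))) (at u)"
  proof (rule has_field_derivative_inverse_strong_x[where S = "am_range q" and f = "elliptic_F q"])
    show "(elliptic_F q has_real_derivative 1 / legendre_delta q (jacobi_am q u)) (at (jacobi_am q u))"
      by (rule elliptic_F_deriv[OF jacobi_am(1)])
    show "1 / legendre_delta q (jacobi_am q u) \<noteq> 0" using legendre_delta_pos[OF jacobi_am(1), of u] by simp
    show "continuous_on (am_range q) (elliptic_F q)"
      using elliptic_F_deriv DERIV_isCont by (intro continuous_at_imp_continuous_on) blast
  qed (auto simp: open_am_range jacobi_am jacobi_am_elliptic_F)
  then show ?thesis by simp
qed

lemma jacobi_triple_am:
  "jacobi_triple q (\<lambda>u. sin (jacobi_am q u)) (\<lambda>u. cos (jacobi_am q u)) (\<lambda>u. legendre_delta q (jacobi_am q u))"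
proof -
  have "((\<lambda>u. legendre_delta q (jacobi_am q u)) has_real_derivative
      - q\<^sup>2 * sin (jacobi_am q u) * cos (jacobi_am q u)) (at u)" for u
  proof -
    define a where "a = jacobi_am q u"
    have a: "1 - q\<^sup>2 * (sin a)\<^sup>2 > 0" using modular_pos[OF jacobi_am(1)] by (simp add: a_def)
    have "((\<lambda>u. sqrt (1 - q\<^sup>2 * (sin (jacobi_am q u))\<^sup>2)) has_real_derivative
      - q\<^sup>2 * sin a * cos a) (at u)"
      using a legendre_delta_pos[OF jacobi_am(1), of u]
      by (auto intro!: derivative_eq_intros jacobi_am_deriv simp: a_def[symmetric] legendre_delta_def field_simps)
    then show ?thesis by (simp add: a_def legendre_delta_def)
  qed
  then show ?thesis
    unfolding jacobi_triple_def
    using legendre_delta_sq[OF jacobi_am(1)]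
    by (auto intro!: derivative_eq_intros jacobi_am_deriv)
qed

lemma nn_integral_elliptic_F:
  assumes "0 \<le> \<phi>" "\<phi> \<in> am_range q"
  shows "(\<integral>\<^sup>+\<theta>\<in>{0..\<phi>}. ennreal (1 / legendre_delta q \<theta>) \<partial>lborel) = ennreal (elliptic_F q \<phi>)"
proof -
  have r: "x \<in> am_range q" if "0 \<le> x" "x \<le> \<phi>" for x using that assms by (auto simp: am_range_def)
  have "(\<integral>\<^sup>+\<theta>\<in>{0..\<phi>}. ennreal (1 / legendre_delta q \<theta>) \<partial>lborel) = ennreal (elliptic_F q \<phi> - elliptic_F q 0)"
  proof (rule nn_integral_FTC_Icc)
    show "(\<lambda>\<theta>. 1 / legendre_delta q \<theta>) \<in> borel_measurable borel" unfolding legendre_delta_def by measurable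
    show "(elliptic_F q has_real_derivative 1 / legendre_delta q x) (at x)" if "x \<in> {0..\<phi>}" for x
      using elliptic_F_deriv r that by simp
    show "0 \<le> 1 / legendre_delta q x" if "x \<in> {0..\<phi>}" for x using legendre_delta_pos[OF r] that by (simp add: less_imp_le)
  qed (use assms in auto)
  then show ?thesis by (simp add: elliptic_F_0)
qed

lemma elliptic_K_eq_elliptic_F:
  assumes "q < 1"
  shows "elliptic_K q = ereal (elliptic_F q (pi / 2))"
proof -
  have r: "pi / 2 \<in> am_range q" using assms by (auto simp: am_range_def)
  have "elliptic_F q 0 < elliptic_F q (pi / 2)"
    using r zero_in_am_range by (intro elliptic_F_less) auto
  then show ?thesis
    using nn_integral_elliptic_F[OF _ r] by (simp add: elliptic_K_def legendre_delta_def elliptic_F_0)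
qed

text \<open>
  The integrand is symmetric about \<open>\<pi>/2\<close>, so \<open>F(\<pi> - x) + F(x)\<close> is constant; compare \<open>x = 0\<close> with
  \<open>x = \<pi>/2\<close>.
\<close>

lemma elliptic_F_pi:
  assumes "q < 1"
  shows "elliptic_F q pi = 2 * elliptic_F q (pi / 2)"
proof -
  have all: "x \<in> am_range q" for x using assms by (auto simp: am_range_def)
  define g where "g x = elliptic_F q (pi - x) + elliptic_F q x" for x
  have "(g has_real_derivative 0) (at x)" for x
  proof -
    have "legendre_delta q (pi - x) = legendre_delta q x" by (simp add: legendre_delta_def)
    then have D: "(elliptic_F q has_real_derivative 1 / legendre_delta q x) (at (pi - x))"
      using elliptic_F_deriv[OF all, of "pi - x"] by simp
    have "((\<lambda>x. elliptic_F q (pi - x)) has_real_derivative 1 / legendre_delta q x * (0 - 1)) (at x)"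
      by (rule DERIV_chain2[where f = "elliptic_F q" and g = "\<lambda>x. pi - x", OF D]) (auto intro!: derivative_eq_intros)
    then show ?thesis
      unfolding g_def[abs_def] using elliptic_F_deriv[OF all, of x] by (auto intro!: derivative_eq_intros)
  qed
  then have "g (pi / 2) = g 0" by (rule DERIV_isconst_all[rule_format])
  then show ?thesis by (simp add: g_def elliptic_F_0)
qed

end

text \<open>
  For each \<open>n\<close> the integral up to the amplitude of \<open>n\<close>, which lies below \<open>\<pi>/2\<close>, is already \<open>n\<close>.
\<close>

lemma elliptic_K_1: "elliptic_K 1 = \<infinity>"
proof -
  define I where "I = (\<integral>\<^sup>+\<theta>\<in>{0..pi/2}. ennreal (1 / sqrt (1 - 1\<^sup>2 * (sin \<theta>)\<^sup>2)) \<partial>lborel)"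
  have le: "ennreal (real n) \<le> I" for n
  proof -
    define \<phi> where "\<phi> = jacobi_am 1 (real n)"
    have \<phi>: "\<phi> \<in> am_range 1" "elliptic_F 1 \<phi> = real n"
      using jacobi_am[of 1 "real n"] by (auto simp: \<phi>_def)
    have "\<phi> \<ge> 0" using jacobi_am_less_iff[of 1 "real n" 0] jacobi_am_0[of 1] by (auto simp: \<phi>_def not_less[symmetric])
    then have "ennreal (real n) = (\<integral>\<^sup>+\<theta>\<in>{0..\<phi>}. ennreal (1 / legendre_delta 1 \<theta>) \<partial>lborel)"
      using nn_integral_elliptic_F[of 1 \<phi>] \<phi> by simp
    also have "\<dots> \<le> I"
      unfolding I_def legendre_delta_def
      using \<phi> by (intro nn_integral_mono) (auto split: split_indicator simp: am_range_def)
    finally show ?thesis .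
  qed
  have "I = top"
  proof (rule ccontr)
    assume "I \<noteq> top"
    then obtain r where r: "I = ennreal r" "r \<ge> 0" by (cases I) auto
    obtain n where "r < real n" using reals_Archimedean2 by blast
    then show False using le[of n] r by (simp add: ennreal_le_iff)
  qed
  then show ?thesis by (simp add: elliptic_K_def I_def top_ereal_def)
qed

section \<open>Values of the Jacobi functions on the two lines\<close>

text \<open>
  The complementary modulus is less than 1, also for \<open>q = 1\<close>, so \<open>K'\<close> is finite.
\<close>

lemma elliptic_K'_amplitude:
  assumes "0 < q" "q \<le> 1"
  shows "jacobi_am (sqrt (1 - q\<^sup>2)) (elliptic_K' q) = pi / 2"
proof -
  let ?k = "sqrt (1 - q\<^sup>2)"
  have "q\<^sup>2 \<le> 1" using assms by (simp add: power_le_one)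
  then have k: "0 \<le> ?k" "?k < 1" using assms by auto
  then have "elliptic_K' q = elliptic_F ?k (pi / 2)"
    by (simp add: elliptic_K'_def elliptic_K_eq_elliptic_F)
  moreover have "pi / 2 \<in> am_range ?k" using k by (auto simp: am_range_def)
  ultimately show ?thesis using k by (simp add: jacobi_am_elliptic_F)
qed

text \<open>
  The complex functions of the first part are nicely meromorphic and restrict to the real ones on the
  real line, since the functions of index 1 are \<open>0, 1, 1\<close> at \<open>y = 0\<close>; hence they are the
  continuations. On the line \<open>y = K'\<close> the functions of index 1 have the values \<open>1, 0, q\<close>.
\<close>

lemma
  fixes q :: real
  assumes q: "0 < q" "q \<le> 1"
  shows jacobi_sn_real: "jacobi_sn q (of_real t) = of_real (sin (jacobi_am q t))"
    and jacobi_cn_real: "jacobi_cn q (of_real t) = of_real (cos (jacobi_am q t))"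
    and jacobi_dn_real: "jacobi_dn q (of_real t) = of_real (legendre_delta q (jacobi_am q t))"
    and jacobi_sn_shift: "jacobi_sn q (of_real t + \<i> * of_real (elliptic_K' q)) =
        of_real (1 / (q * sin (jacobi_am q t)))"
    and jacobi_cn_shift: "\<i> * jacobi_cn q (of_real t + \<i> * of_real (elliptic_K' q)) =
        of_real (legendre_delta q (jacobi_am q t) / (q * sin (jacobi_am q t)))"
    and jacobi_dn_shift: "\<i> * jacobi_dn q (of_real t + \<i> * of_real (elliptic_K' q)) =
        of_real (cos (jacobi_am q t) / sin (jacobi_am q t))"
proof -
  define k where "k = sqrt (1 - q\<^sup>2)"
  have "q\<^sup>2 \<le> 1" using q by (simp add: power_le_one)
  then have k: "0 \<le> k" "k \<le> 1" "q\<^sup>2 + k\<^sup>2 = 1" using q by (auto simp: k_def)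
  define s c d where "s = (\<lambda>u. sin (jacobi_am q u))" and "c = (\<lambda>u. cos (jacobi_am q u))"
    and "d = (\<lambda>u. legendre_delta q (jacobi_am q u))"
  define s\<^sub>1 c\<^sub>1 d\<^sub>1 where "s\<^sub>1 = (\<lambda>u. sin (jacobi_am k u))" and "c\<^sub>1 = (\<lambda>u. cos (jacobi_am k u))"
    and "d\<^sub>1 = (\<lambda>u. legendre_delta k (jacobi_am k u))"
  note defs = s_def c_def d_def s\<^sub>1_def c\<^sub>1_def d\<^sub>1_def
  have ext: "jacobi_extension q k s c d s\<^sub>1 c\<^sub>1 d\<^sub>1"
    unfolding defs using q k jacobi_triple_am by unfold_locales auto
  have at0: "s\<^sub>1 0 = 0" "c\<^sub>1 0 = 1" "d\<^sub>1 0 = 1"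
    using jacobi_am_0[of k] k by (auto simp: defs legendre_delta_def)
  have amK: "jacobi_am k (elliptic_K' q) = pi / 2"
    unfolding k_def by (rule elliptic_K'_amplitude[OF q])
  have atK: "s\<^sub>1 (elliptic_K' q) = 1" "c\<^sub>1 (elliptic_K' q) = 0" "d\<^sub>1 (elliptic_K' q) = q"
    unfolding defs amK legendre_delta_def using k q by (simp_all add: k_def)
  note real = complex_sn_def complex_cn_def complex_dn_def jacobi_den_def at0 complex_eq_iff
  have sn: "jacobi_sn q = complex_sn q s c d s\<^sub>1 c\<^sub>1 d\<^sub>1"
    unfolding jacobi_sn_def
    by (rule mero_continuation_eqI[OF jacobi_extension.nicely_meromorphic(1)[OF ext]])
      (simp add: real s_def)
  have cn: "jacobi_cn q = complex_cn q s c d s\<^sub>1 c\<^sub>1 d\<^sub>1"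
    unfolding jacobi_cn_def
    by (rule mero_continuation_eqI[OF jacobi_extension.nicely_meromorphic(2)[OF ext]])
      (simp add: real c_def)
  have dn: "jacobi_dn q = complex_dn q s c d s\<^sub>1 c\<^sub>1 d\<^sub>1"
    unfolding jacobi_dn_def
    by (rule mero_continuation_eqI[OF jacobi_extension.nicely_meromorphic(3)[OF ext]])
      (simp add: real d_def legendre_delta_def)
  show "jacobi_sn q (of_real t) = of_real (sin (jacobi_am q t))"
    by (simp add: sn real s_def)
  show "jacobi_cn q (of_real t) = of_real (cos (jacobi_am q t))"
    by (simp add: cn real c_def)
  show "jacobi_dn q (of_real t) = of_real (legendre_delta q (jacobi_am q t))"
    by (simp add: dn real d_def)
  note shift = complex_sn_def complex_cn_def complex_dn_def jacobi_den_def atK complex_eq_iff power2_eq_square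
  show "jacobi_sn q (of_real t + \<i> * of_real (elliptic_K' q)) =
        of_real (1 / (q * sin (jacobi_am q t)))"
    using q by (simp add: sn shift) (simp add: s_def)
  show "\<i> * jacobi_cn q (of_real t + \<i> * of_real (elliptic_K' q)) =
        of_real (legendre_delta q (jacobi_am q t) / (q * sin (jacobi_am q t)))"
    using q by (simp add: cn shift) (simp add: s_def d_def)
  show "\<i> * jacobi_dn q (of_real t + \<i> * of_real (elliptic_K' q)) =
        of_real (cos (jacobi_am q t) / sin (jacobi_am q t))"
    using q by (simp add: dn shift) (simp add: s_def c_def)
qed

section \<open>Extended values and the amplitude near the ends of the interval\<close>

lemma ereal_at_within_endpoints_nontrivial:
  fixes b :: ereal
  assumes "0 < b"
  shows "at 0 within {0<..<b} \<noteq> bot" "at b within {0<..<b} \<noteq> bot"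
proof -
  show "at 0 within {0<..<b} \<noteq> bot"
  proof
    assume "at 0 within {0<..<b} = bot"
    then have "eventually (\<lambda>_. False) (at 0 within {0<..<b})" by simp
    then obtain S where S: "open S" "0 \<in> S" "\<And>x. x \<in> S \<Longrightarrow> x \<noteq> 0 \<Longrightarrow> x \<in> {0<..<b} \<Longrightarrow> False"
      unfolding eventually_at_topological by blast
    obtain e where e: "e > 0" "{0..<e} \<subseteq> S" using open_right[OF S(1,2) assms] by auto
    obtain x where x: "0 < x" "x < min e b" using dense[of 0 "min e b"] e assms by auto
    then have "x \<in> S" by (intro subsetD[OF e(2)]) auto
    then show False using S(3)[of x] x by auto
  qed
  show "at b within {0<..<b} \<noteq> bot"
  proof
    assume "at b within {0<..<b} = bot"
    then have "eventually (\<lambda>_. False) (at b within {0<..<b})" by simp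
    then obtain S where S: "open S" "b \<in> S" "\<And>x. x \<in> S \<Longrightarrow> x \<noteq> b \<Longrightarrow> x \<in> {0<..<b} \<Longrightarrow> False"
      unfolding eventually_at_topological by blast
    obtain e where e: "e < b" "{e<..b} \<subseteq> S" using open_left[OF S(1,2) assms] by auto
    obtain x where x: "max e 0 < x" "x < b" using dense[of "max e 0" b] e assms by auto
    then have "x \<in> S" by (intro subsetD[OF e(2)]) auto
    then show False using S(3)[of x] x by auto
  qed
qed

lemma ext_value_unique:
  assumes "ext_value b f \<gamma> v" "ext_value b f \<gamma> w" "\<gamma> \<in> {0..b}" "0 < b"
  shows "v = w"
proof (cases "0 < \<gamma> \<and> \<gamma> < b")
  case True
  then show ?thesis using assms(1,2) by (auto simp: ext_value_def simp flip: of_real_eq_iff[where 'a = complex])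
next
  case False
  then have "\<gamma> = 0 \<or> \<gamma> = b" using assms(3) by auto
  then have "at \<gamma> within {0<..<b} \<noteq> bot"
    using ereal_at_within_endpoints_nontrivial[OF assms(4)] by auto
  then show ?thesis
    using assms(1,2) False unfolding ext_value_def by (simp, blast intro: tendsto_unique)
qed

lemma esinh_eq_iff: "esinh x = esinh y \<longleftrightarrow> x = y"
  by (cases x; cases y) (auto simp: esinh_def)

lemma etanh_eq_iff: "etanh x = etanh y \<longleftrightarrow> x = y"
proof -
  have "tanh t \<noteq> 1" "tanh t \<noteq> -1" "1 \<noteq> tanh t" "-1 \<noteq> tanh t" for t :: real
    using tanh_real_lt_1[of t] tanh_real_gt_neg1[of t] by auto
  moreover have "(- 1 :: ereal) = ereal (- 1)" by (simp add: one_ereal_def)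
  ultimately show ?thesis by (cases x; cases y) (auto simp: etanh_def)
qed

text \<open>
  The amplitude of the end \<open>2K\<close> of the interval, or its limit for \<open>q = 1\<close>, where \<open>2K = \<infinity>\<close>.
\<close>

definition am_max :: "real \<Rightarrow> real" where
  "am_max q = (if q = 1 then pi / 2 else pi)"

lemma am_max_bounds: "0 < am_max q" "am_max q \<le> pi"
  by (auto simp: am_max_def)

context
  fixes q :: real
  assumes q: "0 < q" "q \<le> 1"
begin

lemma below_am_max: "0 \<le> \<phi> \<Longrightarrow> \<phi> < am_max q \<Longrightarrow> \<phi> \<in> am_range q"
  by (auto simp: am_max_def am_range_def split: if_splits)

lemma two_K: "2 * elliptic_K q = (if q = 1 then \<infinity> else ereal (elliptic_F q pi))"
  using elliptic_K_1 elliptic_K_eq_elliptic_F[of q] elliptic_F_pi[of q] q by (auto simp: ereal_mult_infty)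

lemma less_two_K_iff: "ereal t < 2 * elliptic_K q \<longleftrightarrow> jacobi_am q t < am_max q"
proof (cases "q = 1")
  case True
  then show ?thesis using jacobi_am(1)[of q t] unfolding two_K by (simp add: am_max_def am_range_def)
next
  case False
  then have "jacobi_am q (elliptic_F q pi) = pi"
    using q by (intro jacobi_am_elliptic_F) (auto simp: am_range_def)
  then show ?thesis
    using jacobi_am_less_iff[of q t "elliptic_F q pi"] q False unfolding two_K by (simp add: am_max_def)
qed

lemma jacobi_am_pos_iff: "0 < jacobi_am q t \<longleftrightarrow> 0 < t"
  using jacobi_am_less_iff[of q 0 t] jacobi_am_0[of q] q by simp

lemma two_K_pos: "0 < 2 * elliptic_K q"
  using less_two_K_iff[of 0] jacobi_am_0[of q] am_max_bounds q by (simp add: zero_ereal_def)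

lemma interior_ereal_cases:
  assumes "0 < s" "s < 2 * elliptic_K q"
  obtains t where "s = ereal t" "0 < t" "0 < jacobi_am q t" "jacobi_am q t < am_max q"
proof -
  obtain t where t: "s = ereal t" using assms by (cases s) auto
  then show ?thesis using that assms less_two_K_iff[of t] jacobi_am_pos_iff[of t] by auto
qed

lemma elliptic_F_interior:
  assumes "0 < \<phi>" "\<phi> < am_max q"
  shows "0 < elliptic_F q \<phi>" "ereal (elliptic_F q \<phi>) < 2 * elliptic_K q"
    "jacobi_am q (elliptic_F q \<phi>) = \<phi>"
proof -
  show *: "jacobi_am q (elliptic_F q \<phi>) = \<phi>"
    using q below_am_max assms by (simp add: jacobi_am_elliptic_F)
  show "0 < elliptic_F q \<phi>" "ereal (elliptic_F q \<phi>) < 2 * elliptic_K q"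
    using jacobi_am_pos_iff[of "elliptic_F q \<phi>"] less_two_K_iff[of "elliptic_F q \<phi>"] * assms by auto
qed

lemma eventually_interior:
  "\<forall>\<^sub>F s in at \<gamma> within {0<..<2 * elliptic_K q}.
     0 < jacobi_am q (real_of_ereal s) \<and> jacobi_am q (real_of_ereal s) < am_max q"
  unfolding eventually_at_topological
  by (intro exI[of _ UNIV]) (auto elim!: interior_ereal_cases)

text \<open>
  Together with the next lemma this turns one-sided limits in the extended real variable, whose
  right end may be infinite, into limits in the angle.
\<close>

lemma filterlim_am_at_0:
  "filterlim (\<lambda>s. jacobi_am q (real_of_ereal s)) (at_right 0) (at 0 within {0<..<2 * elliptic_K q})"
  unfolding filterlim_at
proof (intro conjI)
  show "\<forall>\<^sub>F s in at 0 within {0<..<2 * elliptic_K q}.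
      jacobi_am q (real_of_ereal s) \<in> {0<..} \<and> jacobi_am q (real_of_ereal s) \<noteq> 0"
    using eventually_interior by eventually_elim auto
  show "((\<lambda>s. jacobi_am q (real_of_ereal s)) \<longlongrightarrow> 0) (at 0 within {0<..<2 * elliptic_K q})"
  proof (rule order_tendstoI)
    fix a :: real assume a: "a < 0"
    show "\<forall>\<^sub>F s in at 0 within {0<..<2 * elliptic_K q}. a < jacobi_am q (real_of_ereal s)"
      using eventually_interior by eventually_elim (use a in auto)
  next
    fix a :: real assume "0 < a"
    obtain a' where a': "0 < a'" "a' < min a (am_max q)"
      using dense[of 0 "min a (am_max q)"] \<open>0 < a\<close> am_max_bounds by auto
    note F = elliptic_F_interior[of a']
    show "\<forall>\<^sub>F s in at 0 within {0<..<2 * elliptic_K q}. jacobi_am q (real_of_ereal s) < a"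
      unfolding eventually_at_topological
    proof (intro exI[of _ "{..<ereal (elliptic_F q a')}"] conjI ballI impI)
      fix s assume "s \<in> {..<ereal (elliptic_F q a')}" "s \<in> {0<..<2 * elliptic_K q}"
      then obtain t where "s = ereal t" "t < elliptic_F q a'" by (auto elim!: interior_ereal_cases)
      then show "jacobi_am q (real_of_ereal s) < a"
        using jacobi_am_less_iff[of q t "elliptic_F q a'"] q F a' by auto
    qed (use F a' in auto)
  qed
qed

lemma filterlim_am_at_2K:
  "filterlim (\<lambda>s. jacobi_am q (real_of_ereal s)) (at_left (am_max q))
     (at (2 * elliptic_K q) within {0<..<2 * elliptic_K q})"
  unfolding filterlim_at
proof (intro conjI)
  show "\<forall>\<^sub>F s in at (2 * elliptic_K q) within {0<..<2 * elliptic_K q}.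
      jacobi_am q (real_of_ereal s) \<in> {..<am_max q} \<and> jacobi_am q (real_of_ereal s) \<noteq> am_max q"
    using eventually_interior by eventually_elim auto
  show "((\<lambda>s. jacobi_am q (real_of_ereal s)) \<longlongrightarrow> am_max q)
      (at (2 * elliptic_K q) within {0<..<2 * elliptic_K q})"
  proof (rule order_tendstoI)
    fix a :: real assume a: "am_max q < a"
    show "\<forall>\<^sub>F s in at (2 * elliptic_K q) within {0<..<2 * elliptic_K q}. jacobi_am q (real_of_ereal s) < a"
      using eventually_interior by eventually_elim (use a in auto)
  next
    fix a :: real assume "a < am_max q"
    obtain a' where a': "max 0 a < a'" "a' < am_max q"
      using dense[of "max 0 a" "am_max q"] \<open>a < am_max q\<close> am_max_bounds by auto
    note F = elliptic_F_interior[of a']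
    show "\<forall>\<^sub>F s in at (2 * elliptic_K q) within {0<..<2 * elliptic_K q}. a < jacobi_am q (real_of_ereal s)"
      unfolding eventually_at_topological
    proof (intro exI[of _ "{ereal (elliptic_F q a')<..}"] conjI ballI impI)
      fix s assume "s \<in> {ereal (elliptic_F q a')<..}" "s \<in> {0<..<2 * elliptic_K q}"
      then obtain t where "s = ereal t" "elliptic_F q a' < t" by (auto elim!: interior_ereal_cases)
      then show "a < jacobi_am q (real_of_ereal s)"
        using jacobi_am_less_iff[of q "elliptic_F q a'" t] q F a' by auto
    qed (use F a' in auto)
  qed
qed

lemma ext_value_interior:
  assumes "\<And>t. f t = complex_of_real (G (jacobi_am q t))" "0 < \<gamma>" "\<gamma> < 2 * elliptic_K q"
  shows "ext_value (2 * elliptic_K q) f \<gamma> (ereal (G (jacobi_am q (real_of_ereal \<gamma>))))"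
  using assms by (auto simp: ext_value_def)

lemma ext_value_at_0:
  assumes "\<And>t. f t = complex_of_real (G (jacobi_am q t))"
    and "((\<lambda>\<phi>. ereal (G \<phi>)) \<longlongrightarrow> v) (at_right 0)"
  shows "ext_value (2 * elliptic_K q) f 0 v"
  using filterlim_compose[OF assms(2) filterlim_am_at_0] assms(1) by (simp add: ext_value_def)

lemma ext_value_at_2K:
  assumes "\<And>t. f t = complex_of_real (G (jacobi_am q t))"
    and "((\<lambda>\<phi>. ereal (G \<phi>)) \<longlongrightarrow> v) (at_left (am_max q))"
  shows "ext_value (2 * elliptic_K q) f (2 * elliptic_K q) v"
  using filterlim_compose[OF assms(2) filterlim_am_at_2K] assms(1) by (simp add: ext_value_def)

end

section \<open>The ring belonging to a value of the variable\<close>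

text \<open>
  The interval of the variable is written with the extended real \<^term>\<open>2 * elliptic_K q\<close> throughout;
  rewriting its numeral to a coerced real would hide it from the facts below.
\<close>

declare numeral_eq_ereal [simp del]

lemma ecosh_simps: "ecosh \<infinity> = \<infinity>" "ecosh 0 = 1" "ecosh (ereal t) = ereal (cosh t)"
  and esinh_simps: "esinh \<infinity> = \<infinity>" "esinh (-\<infinity>) = -\<infinity>" "esinh 0 = 0" "esinh (ereal t) = ereal (sinh t)"
  and etanh_simps: "etanh \<infinity> = 1" "etanh 0 = 0" "etanh (ereal t) = ereal (tanh t)"
  by (simp_all add: ecosh_def esinh_def etanh_def zero_ereal_def one_ereal_def)

lemma tendsto_PInfty_of_at_top:
  "filterlim g at_top F \<Longrightarrow> ((\<lambda>x. ereal (g x)) \<longlongrightarrow> \<infinity>) F"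
  by (simp add: tendsto_PInfty filterlim_at_top_dense)

lemma tendsto_MInfty_of_at_bot:
  "filterlim g at_bot F \<Longrightarrow> ((\<lambda>x. ereal (g x)) \<longlongrightarrow> -\<infinity>) F"
  by (simp add: tendsto_MInfty filterlim_at_bot_dense)

lemma filterlim_sin_0: "filterlim sin (at_right 0) (at_right (0::real))"
  unfolding filterlim_at
proof (intro conjI)
  have "\<forall>\<^sub>F x in at_right 0. x \<in> {0<..<pi}" by (intro eventually_at_right_real) simp
  then show "\<forall>\<^sub>F x in at_right (0::real). sin x \<in> {0<..} \<and> sin x \<noteq> 0"
    by eventually_elim (auto dest: sin_gt_zero)
  have "(sin \<longlongrightarrow> sin 0) (at_right (0::real))" by (intro tendsto_intros)
  then show "(sin \<longlongrightarrow> 0) (at_right (0::real))" by simp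
qed

lemma filterlim_sin_pi: "filterlim sin (at_right 0) (at_left pi)"
  unfolding filterlim_at
proof (intro conjI)
  have "\<forall>\<^sub>F x in at_left pi. x \<in> {0<..<pi}" by (intro eventually_at_left_real) simp
  then show "\<forall>\<^sub>F x in at_left pi. sin x \<in> {0<..} \<and> sin x \<noteq> 0"
    by eventually_elim (auto dest: sin_gt_zero)
  have "(sin \<longlongrightarrow> sin pi) (at_left pi)" by (intro tendsto_intros)
  then show "(sin \<longlongrightarrow> 0) (at_left pi)" by simp
qed

lemma arctan_cot: "0 < \<phi> \<Longrightarrow> \<phi> < pi \<Longrightarrow> arctan (cos \<phi> / sin \<phi>) = pi / 2 - \<phi>"
  using arctan_tan[of "pi / 2 - \<phi>"] by (simp add: tan_def sin_diff cos_diff)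

lemma cosh_arsinh_cot:
  assumes "0 < \<phi>" "\<phi> < pi"
  shows "cosh (arsinh (cos \<phi> / sin \<phi>)) = 1 / sin \<phi>"
proof -
  have s: "sin \<phi> > 0" using assms by (rule sin_gt_zero)
  have "(cos \<phi> / sin \<phi>)\<^sup>2 + 1 = (1 / sin \<phi>)\<^sup>2"
    using s by (simp add: power_divide cos_squared_eq field_simps)
  then show ?thesis using s by (simp add: cosh_arsinh_real)
qed

text \<open>
  With \<open>\<phi>\<close> the amplitude of the variable, \<open>sinh r = cot \<phi>\<close> and \<open>cosh R = 1 / (q sin \<phi>)\<close>. The values at
  the ends are the limits, at \<open>\<phi> = 0\<close> and at \<open>\<phi> = \<pi>\<close> or, for \<open>q = 1\<close>, at \<open>\<phi> = \<pi>/2\<close>.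
\<close>

definition ring_of_variable :: "real \<Rightarrow> ereal \<Rightarrow> ereal \<times> ereal" where
  "ring_of_variable q \<gamma> =
     (if \<gamma> = 0 then (\<infinity>, \<infinity>)
      else if \<gamma> = 2 * elliptic_K q then (if q = 1 then (0, 0) else (-\<infinity>, \<infinity>))
      else let \<phi> = jacobi_am q (real_of_ereal \<gamma>)
           in (ereal (arsinh (cos \<phi> / sin \<phi>)), ereal (arcosh (1 / (q * sin \<phi>)))))"

lemma ring_of_variable_0: "ring_of_variable q 0 = (\<infinity>, \<infinity>)"
  by (simp add: ring_of_variable_def)

context
  fixes q :: real
  assumes q: "0 < q" "q \<le> 1"
begin

lemma ring_of_variable_2K:
  "ring_of_variable q (2 * elliptic_K q) = (if q = 1 then (0, 0) else (-\<infinity>, \<infinity>))"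
proof -
  have "2 * elliptic_K q \<noteq> 0" using two_K_pos[OF q] by auto
  then show ?thesis unfolding ring_of_variable_def by (simp only: if_False if_True refl)
qed

lemma arcosh_outer_radius:
  assumes "0 < \<phi>" "\<phi> < am_max q"
  defines "R \<equiv> arcosh (1 / (q * sin \<phi>))"
  shows "0 \<le> R" "cosh R = 1 / (q * sin \<phi>)" "sinh R = legendre_delta q \<phi> / (q * sin \<phi>)"
    "tanh R = legendre_delta q \<phi>"
proof -
  have s: "sin \<phi> > 0" using assms am_max_bounds[of q] q by (intro sin_gt_zero) auto
  have "q * sin \<phi> \<le> 1 * 1" using q s by (intro mult_mono) auto
  then have ge: "1 / (q * sin \<phi>) \<ge> 1" using q s by simp
  show "0 \<le> R" unfolding R_def using ge by simp
  show c: "cosh R = 1 / (q * sin \<phi>)" unfolding R_def using ge by simp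
  have r: "\<phi> \<in> am_range q" using below_am_max[OF q] assms by simp
  have "(sinh R)\<^sup>2 = (legendre_delta q \<phi> / (q * sin \<phi>))\<^sup>2"
    using s q legendre_delta_sq[OF _ q(2) r] by (simp add: sinh_square_eq c power_divide power_mult_distrib field_simps)
  moreover have "sinh R \<ge> 0" using \<open>0 \<le> R\<close> by simp
  moreover have "legendre_delta q \<phi> / (q * sin \<phi>) \<ge> 0" using legendre_delta_pos[OF _ q(2) r] q s by simp
  ultimately show sh: "sinh R = legendre_delta q \<phi> / (q * sin \<phi>)" by (simp add: power2_eq_iff_nonneg)
  show "tanh R = legendre_delta q \<phi>" using s q by (simp add: tanh_def sh c)
qed

lemma limits_where_sin_vanishes:
  assumes sin: "filterlim sin (at_right 0) F"
  shows "((\<lambda>\<phi>. ereal (1 / (q * sin \<phi>))) \<longlongrightarrow> \<infinity>) F"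
    and "((\<lambda>\<phi>. ereal (legendre_delta q \<phi> / (q * sin \<phi>))) \<longlongrightarrow> \<infinity>) F"
    and "((\<lambda>\<phi>. ereal (legendre_delta q \<phi>)) \<longlongrightarrow> 1) F"
proof -
  have i: "filterlim (\<lambda>\<phi>. inverse (sin \<phi>)) at_top F"
    by (rule filterlim_compose[OF filterlim_inverse_at_top_right sin])
  have "(sin \<longlongrightarrow> 0) F" using sin by (simp add: filterlim_at)
  then have "((\<lambda>\<phi>. sqrt (1 - q\<^sup>2 * (sin \<phi>)\<^sup>2)) \<longlongrightarrow> sqrt (1 - q\<^sup>2 * 0\<^sup>2)) F"
    by (intro tendsto_intros)
  then have d: "(legendre_delta q \<longlongrightarrow> 1) F" by (simp add: legendre_delta_def[abs_def])
  have "filterlim (\<lambda>\<phi>. (1 / q) * inverse (sin \<phi>)) at_top F"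
    by (rule filterlim_tendsto_pos_mult_at_top[OF tendsto_const _ i]) (use q in simp)
  then show "((\<lambda>\<phi>. ereal (1 / (q * sin \<phi>))) \<longlongrightarrow> \<infinity>) F"
    by (intro tendsto_PInfty_of_at_top) (simp add: field_simps)
  have "filterlim (\<lambda>\<phi>. (legendre_delta q \<phi> / q) * inverse (sin \<phi>)) at_top F"
    by (rule filterlim_tendsto_pos_mult_at_top[OF tendsto_divide[OF d tendsto_const] _ i]) (use q in auto)
  then show "((\<lambda>\<phi>. ereal (legendre_delta q \<phi> / (q * sin \<phi>))) \<longlongrightarrow> \<infinity>) F"
    by (intro tendsto_PInfty_of_at_top) (simp add: field_simps)
  show "((\<lambda>\<phi>. ereal (legendre_delta q \<phi>)) \<longlongrightarrow> 1) F"
    using d by (simp add: one_ereal_def)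
qed

lemma cot_at_0: "((\<lambda>\<phi>. ereal (cos \<phi> / sin \<phi>)) \<longlongrightarrow> \<infinity>) (at_right 0)"
proof -
  have i: "filterlim (\<lambda>\<phi>. inverse (sin \<phi>)) at_top (at_right (0::real))"
    by (rule filterlim_compose[OF filterlim_inverse_at_top_right filterlim_sin_0])
  have "(cos \<longlongrightarrow> cos 0) (at_right (0::real))" by (intro tendsto_intros)
  then have "filterlim (\<lambda>\<phi>. cos \<phi> * inverse (sin \<phi>)) at_top (at_right (0::real))"
    by (rule filterlim_tendsto_pos_mult_at_top[OF _ _ i]) simp
  then show ?thesis
    by (intro tendsto_PInfty_of_at_top) (simp add: field_simps)
qed

lemma cot_at_pi: "((\<lambda>\<phi>. ereal (cos \<phi> / sin \<phi>)) \<longlongrightarrow> -\<infinity>) (at_left pi)"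
proof -
  have i: "filterlim (\<lambda>\<phi>. inverse (sin \<phi>)) at_top (at_left pi)"
    by (rule filterlim_compose[OF filterlim_inverse_at_top_right filterlim_sin_pi])
  have "(cos \<longlongrightarrow> cos pi) (at_left pi)" by (intro tendsto_intros)
  then have "filterlim (\<lambda>\<phi>. cos \<phi> * inverse (sin \<phi>)) at_bot (at_left pi)"
    by (rule filterlim_tendsto_neg_mult_at_bot[OF _ _ i]) simp
  then show ?thesis
    by (intro tendsto_MInfty_of_at_bot) (simp add: field_simps)
qed

lemmas limits_at_0 = limits_where_sin_vanishes[OF filterlim_sin_0] cot_at_0
lemmas limits_at_pi = limits_where_sin_vanishes[OF filterlim_sin_pi] cot_at_pi

lemma limits_at_half_pi:
  assumes "q = 1"
  shows "((\<lambda>\<phi>. ereal (1 / (q * sin \<phi>))) \<longlongrightarrow> 1) (at_left (pi / 2))"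
  "((\<lambda>\<phi>. ereal (legendre_delta q \<phi> / (q * sin \<phi>))) \<longlongrightarrow> 0) (at_left (pi / 2))"
  "((\<lambda>\<phi>. ereal (cos \<phi> / sin \<phi>)) \<longlongrightarrow> 0) (at_left (pi / 2))"
  "((\<lambda>\<phi>. ereal (legendre_delta q \<phi>)) \<longlongrightarrow> 0) (at_left (pi / 2))"
proof -
  have "((\<lambda>\<phi>. 1 / (q * sin \<phi>)) \<longlongrightarrow> 1 / (q * sin (pi / 2))) (at_left (pi / 2))"
    using q by (intro tendsto_intros) auto
  then show "((\<lambda>\<phi>. ereal (1 / (q * sin \<phi>))) \<longlongrightarrow> 1) (at_left (pi / 2))"
    using assms by (simp add: one_ereal_def)
  have "((\<lambda>\<phi>. sqrt (1 - q\<^sup>2 * (sin \<phi>)\<^sup>2) / (q * sin \<phi>)) \<longlongrightarrow>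
      sqrt (1 - q\<^sup>2 * (sin (pi / 2))\<^sup>2) / (q * sin (pi / 2))) (at_left (pi / 2))"
    using q by (intro tendsto_intros) auto
  then show "((\<lambda>\<phi>. ereal (legendre_delta q \<phi> / (q * sin \<phi>))) \<longlongrightarrow> 0) (at_left (pi / 2))"
    using assms by (simp add: zero_ereal_def legendre_delta_def)
  have "((\<lambda>\<phi>. sqrt (1 - q\<^sup>2 * (sin \<phi>)\<^sup>2)) \<longlongrightarrow> sqrt (1 - q\<^sup>2 * (sin (pi / 2))\<^sup>2)) (at_left (pi / 2))"
    by (intro tendsto_intros)
  then show "((\<lambda>\<phi>. ereal (legendre_delta q \<phi>)) \<longlongrightarrow> 0) (at_left (pi / 2))"
    using assms by (simp add: zero_ereal_def legendre_delta_def)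
  have "((\<lambda>\<phi>. cos \<phi> / sin \<phi>) \<longlongrightarrow> cos (pi / 2) / sin (pi / 2)) (at_left (pi / 2))"
    by (intro tendsto_intros) auto
  then show "((\<lambda>\<phi>. ereal (cos \<phi> / sin \<phi>)) \<longlongrightarrow> 0) (at_left (pi / 2))"
    by (simp add: zero_ereal_def)
qed

lemma limits_at_2K:
  defines "P \<equiv> ring_of_variable q (2 * elliptic_K q)"
  shows "((\<lambda>\<phi>. ereal (1 / (q * sin \<phi>))) \<longlongrightarrow> ecosh (snd P)) (at_left (am_max q)) \<and>
    ((\<lambda>\<phi>. ereal (legendre_delta q \<phi> / (q * sin \<phi>))) \<longlongrightarrow> esinh (snd P)) (at_left (am_max q)) \<and>
    ((\<lambda>\<phi>. ereal (cos \<phi> / sin \<phi>)) \<longlongrightarrow> esinh (fst P)) (at_left (am_max q)) \<and>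
    ((\<lambda>\<phi>. ereal (legendre_delta q \<phi>)) \<longlongrightarrow> etanh (snd P)) (at_left (am_max q))"
proof (cases "q = 1")
  case True
  then have e: "P = (0, 0)" "am_max q = pi / 2"
    unfolding P_def ring_of_variable_2K by (simp_all add: am_max_def)
  show ?thesis
    unfolding e fst_conv snd_conv ecosh_simps esinh_simps etanh_simps
    by (intro conjI limits_at_half_pi[OF True])
next
  case False
  then have e: "P = (-\<infinity>, \<infinity>)" "am_max q = pi"
    unfolding P_def ring_of_variable_2K by (simp_all add: am_max_def)
  show ?thesis
    unfolding e fst_conv snd_conv ecosh_simps esinh_simps etanh_simps
    by (intro conjI limits_at_pi)
qed

lemma ext_value_ring_of_variable:
  assumes \<gamma>: "\<gamma> \<in> {0..2 * elliptic_K q}"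
  shows "(\<And>t. f t = complex_of_real (1 / (q * sin (jacobi_am q t)))) \<Longrightarrow>
      ext_value (2 * elliptic_K q) f \<gamma> (ecosh (snd (ring_of_variable q \<gamma>)))"
    and "(\<And>t. f t = complex_of_real (legendre_delta q (jacobi_am q t) / (q * sin (jacobi_am q t)))) \<Longrightarrow>
      ext_value (2 * elliptic_K q) f \<gamma> (esinh (snd (ring_of_variable q \<gamma>)))"
    and "(\<And>t. f t = complex_of_real (legendre_delta q (jacobi_am q t))) \<Longrightarrow>
      ext_value (2 * elliptic_K q) f \<gamma> (etanh (snd (ring_of_variable q \<gamma>)))"
    and "(\<And>t. f t = complex_of_real (cos (jacobi_am q t) / sin (jacobi_am q t))) \<Longrightarrow>
      ext_value (2 * elliptic_K q) f \<gamma> (esinh (fst (ring_of_variable q \<gamma>)))"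
proof -
  let ?b = "2 * elliptic_K q" and ?P = "ring_of_variable q"
  \<comment> \<open>All four claims have the form: if a function of the amplitude represents a quantity of the ring
    inside the interval and has the right limits at its ends, then it represents it everywhere.\<close>
  have *: "ext_value ?b f \<gamma> v"
    if f: "\<And>t. f t = complex_of_real (G (jacobi_am q t))"
      and 0: "((\<lambda>\<phi>. ereal (G \<phi>)) \<longlongrightarrow> V (?P 0)) (at_right 0)"
      and 1: "((\<lambda>\<phi>. ereal (G \<phi>)) \<longlongrightarrow> V (?P ?b)) (at_left (am_max q))"
      and i: "\<And>\<phi>. 0 < \<phi> \<Longrightarrow> \<phi> < am_max q \<Longrightarrow>
         V (ereal (arsinh (cos \<phi> / sin \<phi>)), ereal (arcosh (1 / (q * sin \<phi>)))) = ereal (G \<phi>)"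
      and v: "v = V (?P \<gamma>)" for f G V v
  proof -
    consider "\<gamma> = 0" | "\<gamma> = ?b" | "0 < \<gamma>" "\<gamma> < ?b" using \<gamma> by force
    then show ?thesis
    proof cases
      case 1
      then show ?thesis using ext_value_at_0[where f = f and G = G, OF q f that(2)] v by simp
    next
      case 2
      show ?thesis using ext_value_at_2K[where f = f and G = G, OF q f that(3)] v by (simp add: 2)
    next
      case 3
      obtain t where t: "\<gamma> = ereal t" "0 < jacobi_am q t" "jacobi_am q t < am_max q"
        using interior_ereal_cases[OF q 3] by metis
      have "\<gamma> \<noteq> 0" "\<gamma> \<noteq> ?b" using 3 by auto
      then have "V (?P \<gamma>) = ereal (G (jacobi_am q (real_of_ereal \<gamma>)))"
        unfolding ring_of_variable_def Let_def using i[OF t(2,3)] t(1) by simp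
      then show ?thesis using ext_value_interior[where f = f and G = G, OF q f 3] v by simp
    qed
  qed
  show "ext_value ?b f \<gamma> (ecosh (snd (?P \<gamma>)))"
    if "\<And>t. f t = complex_of_real (1 / (q * sin (jacobi_am q t)))"
    by (rule *[where G = "\<lambda>\<phi>. 1 / (q * sin \<phi>)" and V = "\<lambda>p. ecosh (snd p)", OF that]) (simp_all add: ring_of_variable_0 limits_at_0 limits_at_2K arcosh_outer_radius
        ecosh_simps esinh_simps etanh_simps)
  show "ext_value ?b f \<gamma> (esinh (snd (?P \<gamma>)))"
    if "\<And>t. f t = complex_of_real (legendre_delta q (jacobi_am q t) / (q * sin (jacobi_am q t)))"
    by (rule *[where G = "\<lambda>\<phi>. legendre_delta q \<phi> / (q * sin \<phi>)" and V = "\<lambda>p. esinh (snd p)", OF that]) (simp_all add: ring_of_variable_0 limits_at_0 limits_at_2K arcosh_outer_radius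
        ecosh_simps esinh_simps etanh_simps)
  show "ext_value ?b f \<gamma> (etanh (snd (?P \<gamma>)))"
    if "\<And>t. f t = complex_of_real (legendre_delta q (jacobi_am q t))"
    by (rule *[where G = "\<lambda>\<phi>. legendre_delta q \<phi>" and V = "\<lambda>p. etanh (snd p)", OF that]) (simp_all add: ring_of_variable_0 limits_at_0 limits_at_2K arcosh_outer_radius
        ecosh_simps esinh_simps etanh_simps)
  show "ext_value ?b f \<gamma> (esinh (fst (?P \<gamma>)))"
    if "\<And>t. f t = complex_of_real (cos (jacobi_am q t) / sin (jacobi_am q t))"
    by (rule *[where G = "\<lambda>\<phi>. cos \<phi> / sin \<phi>" and V = "\<lambda>p. esinh (fst p)", OF that]) (simp_all add: ring_of_variable_0 limits_at_0 limits_at_2K arcosh_outer_radius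
        ecosh_simps esinh_simps etanh_simps)
qed

end

section \<open>The correspondence is bijective\<close>

context
  fixes q :: real
  assumes q: "0 < q" "q \<le> 1"
begin

lemma ring_of_variable_interior:
  assumes "0 < \<gamma>" "\<gamma> < 2 * elliptic_K q"
  shows "ring_of_variable q \<gamma> =
    (ereal (arsinh (cos (jacobi_am q (real_of_ereal \<gamma>)) / sin (jacobi_am q (real_of_ereal \<gamma>)))),
     ereal (arcosh (1 / (q * sin (jacobi_am q (real_of_ereal \<gamma>))))))"
proof -
  have "\<gamma> \<noteq> 0" "\<gamma> \<noteq> 2 * elliptic_K q" using assms by auto
  then show ?thesis unfolding ring_of_variable_def Let_def by simp
qed

lemma variable_cases:
  assumes "\<gamma> \<in> {0..2 * elliptic_K q}"
  obtains "\<gamma> = 0" | "\<gamma> = 2 * elliptic_K q" | "0 < \<gamma>" "\<gamma> < 2 * elliptic_K q"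
  using assms by force

text \<open>
  For \<open>q = 1\<close> the angle stays below \<open>\<pi>/2\<close>, so the inner radius is positive. This yields the sign
  convention \<open>r = R\<close>.
\<close>

lemma cot_pos_if_q_1:
  assumes "q = 1" "0 < \<phi>" "\<phi> < am_max q"
  shows "0 < cos \<phi> / sin \<phi>"
  using assms by (intro divide_pos_pos cos_gt_zero_pi sin_gt_zero) (auto simp: am_max_def)

text \<open>
  In the interior \<open>cot\<close> is injective on \<open>(0, \<pi>)\<close>; the ends are told apart from the interior and from
  each other by the inner radius.
\<close>

lemma inj_on_ring_of_variable: "inj_on (ring_of_variable q) {0..2 * elliptic_K q}"
proof -
  have z: "fst (ring_of_variable q \<gamma>) \<notin> {\<infinity>, -\<infinity>}" "q = 1 \<Longrightarrow> fst (ring_of_variable q \<gamma>) \<noteq> 0"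
    if i: "0 < \<gamma>" "\<gamma> < 2 * elliptic_K q" for \<gamma>
  proof -
    obtain t where t: "\<gamma> = ereal t" "0 < jacobi_am q t" "jacobi_am q t < am_max q"
      using interior_ereal_cases[OF q i] by metis
    show "fst (ring_of_variable q \<gamma>) \<notin> {\<infinity>, -\<infinity>}" using ring_of_variable_interior[OF i] by simp
    show "fst (ring_of_variable q \<gamma>) \<noteq> 0" if "q = 1"
      using ring_of_variable_interior[OF i] cot_pos_if_q_1[OF that t(2,3)] t(1)
      by (auto simp: zero_ereal_def)
  qed
  have ends: "fst (ring_of_variable q (2 * elliptic_K q)) = (if q = 1 then 0 else -\<infinity>)"
    unfolding ring_of_variable_2K[OF q] by simp
  have end_ne: "ring_of_variable q 0 \<noteq> ring_of_variable q (2 * elliptic_K q)"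
    unfolding ring_of_variable_0 ring_of_variable_2K[OF q] by simp
  have int_ne: "ring_of_variable q \<gamma> \<noteq> ring_of_variable q 0"
    "ring_of_variable q \<gamma> \<noteq> ring_of_variable q (2 * elliptic_K q)"
    if i: "0 < \<gamma>" "\<gamma> < 2 * elliptic_K q" for \<gamma>
  proof -
    show "ring_of_variable q \<gamma> \<noteq> ring_of_variable q 0"
      unfolding ring_of_variable_0 using z(1)[OF i] by auto
    show "ring_of_variable q \<gamma> \<noteq> ring_of_variable q (2 * elliptic_K q)"
    proof
      assume "ring_of_variable q \<gamma> = ring_of_variable q (2 * elliptic_K q)"
      with ends have "fst (ring_of_variable q \<gamma>) = (if q = 1 then 0 else -\<infinity>)" by argo
      then show False using z[OF i] by (simp split: if_splits)
    qed
  qed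
  have inj: "\<gamma> = \<gamma>'" if i: "0 < \<gamma>" "\<gamma> < 2 * elliptic_K q" "0 < \<gamma>'" "\<gamma>' < 2 * elliptic_K q"
    "ring_of_variable q \<gamma> = ring_of_variable q \<gamma>'" for \<gamma> \<gamma>'
  proof -
    obtain t where t: "\<gamma> = ereal t" "0 < jacobi_am q t" "jacobi_am q t < am_max q"
      using interior_ereal_cases[OF q i(1,2)] by metis
    obtain t' where t': "\<gamma>' = ereal t'" "0 < jacobi_am q t'" "jacobi_am q t' < am_max q"
      using interior_ereal_cases[OF q i(3,4)] by metis
    define a a' where "a = jacobi_am q t" and "a' = jacobi_am q t'"
    have "arsinh (cos a / sin a) = arsinh (cos a' / sin a')"
      using i(5) ring_of_variable_interior[OF i(1,2)] ring_of_variable_interior[OF i(3,4)] t t'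
      by (simp add: a_def a'_def)
    then have "cos a / sin a = cos a' / sin a'"
      by (metis sinh_arsinh_real)
    then have "pi / 2 - a = pi / 2 - a'"
      using t t' am_max_bounds(2)[of q] q
      by (subst (1 2) arctan_cot[symmetric]) (auto simp: a_def a'_def)
    then have "jacobi_am q t = jacobi_am q t'" by (simp add: a_def a'_def)
    then have "t = t'" using q by (metis jacobi_am(2) less_imp_le)
    then show ?thesis using t t' by simp
  qed
  show ?thesis
  proof (rule inj_onI)
    fix x y
    assume x: "x \<in> {0..2 * elliptic_K q}" and y: "y \<in> {0..2 * elliptic_K q}"
      and eq: "ring_of_variable q x = ring_of_variable q y"
    show "x = y"
      by (cases rule: variable_cases[OF x]; cases rule: variable_cases[OF y];
          use eq end_ne int_ne inj in metis)
  qed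
qed

context
  fixes R\<^sub>0 :: real
  assumes R0: "0 \<le> R\<^sub>0" "cosh R\<^sub>0 = 1 / q"
begin

lemma ring_of_variable_in_ring_radii:
  assumes \<gamma>: "\<gamma> \<in> {0..2 * elliptic_K q}"
  shows "ring_of_variable q \<gamma> \<in> ring_radii q R\<^sub>0"
  using \<gamma>
proof (cases rule: variable_cases)
  case 1
  then show ?thesis using q by (simp add: ring_of_variable_0 ring_radii_def ecosh_def)
next
  case 2
  have "R\<^sub>0 = 0" if "q = 1" using R0 that by simp
  then show ?thesis
    unfolding 2 ring_of_variable_2K[OF q] using q by (auto simp: ring_radii_def ecosh_def zero_ereal_def)
next
  case 3
  obtain t where t: "\<gamma> = ereal t" "0 < jacobi_am q t" "jacobi_am q t < am_max q"
    using interior_ereal_cases[OF q 3] by metis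
  define a where "a = jacobi_am q t"
  have a: "0 < a" "a < am_max q" "a < pi" using t am_max_bounds(2)[of q] q by (auto simp: a_def)
  define r R where "r = arsinh (cos a / sin a)" and "R = arcosh (1 / (q * sin a))"
  have P: "ring_of_variable q \<gamma> = (ereal r, ereal R)"
    using ring_of_variable_interior[OF 3] t by (simp add: a_def r_def R_def)
  have R: "0 \<le> R" "cosh R = 1 / (q * sin a)"
    using arcosh_outer_radius[OF q a(1,2)] by (auto simp: R_def)
  have r: "cosh r = 1 / sin a" using cosh_arsinh_cot[OF a(1,3)] by (simp add: r_def)
  have s: "sin a > 0" using a by (intro sin_gt_zero)
  have "1 / q \<le> 1 / (q * sin a)" using q s by (simp add: field_simps)
  then have "R\<^sub>0 \<le> R" using R R0 cosh_real_nonneg_le_iff[of R\<^sub>0 R] by simp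
  moreover have "r = R" if "q = 1"
  proof -
    have "0 \<le> sinh r" using cot_pos_if_q_1[OF that a(1,2)] by (simp add: r_def del: sinh_real_nonneg_iff)
    then have "0 \<le> r" by simp
    moreover have "cosh r = cosh R" using r R that by simp
    ultimately show ?thesis using R(1) by (metis arcosh_cosh_real)
  qed
  ultimately show ?thesis using q r R s by (simp add: P ring_radii_def ecosh_def)
qed

text \<open>
  A finite inner radius \<open>\<rho>\<close>, nonzero if \<open>q = 1\<close>, belongs to the angle \<open>\<phi> = \<pi>/2 - arctan (sinh \<rho>)\<close> in \<open>(0, \<pi>)\<close>, and \<open>F(\<phi>)\<close> is
  the variable; the outer radius is then determined by the ring equation and \<open>R \<ge> 0\<close>.
\<close>

lemma ring_radii_covered:
  assumes "(r, R) \<in> ring_radii q R\<^sub>0"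
  shows "\<exists>\<gamma>\<in>{0..2 * elliptic_K q}. ring_of_variable q \<gamma> = (r, R)"
proof -
  have R0R: "ereal R\<^sub>0 \<le> R" and eq: "ecosh r = ereal q * ecosh R" and q1: "q = 1 \<Longrightarrow> r = R"
    using assms by (auto simp: ring_radii_def)
  have K: "0 \<in> {0..2 * elliptic_K q}" "2 * elliptic_K q \<in> {0..2 * elliptic_K q}"
    using two_K_pos[OF q] by auto
  show ?thesis
  proof (cases R)
    case MInf
    then show ?thesis using R0R by simp
  next
    case PInf
    then have "r = \<infinity> \<or> r = -\<infinity>" using eq q by (cases r) (auto simp: ecosh_def)
    moreover have "q \<noteq> 1" if "r = -\<infinity>" using q1 PInf that by auto
    ultimately show ?thesis
      using K ring_of_variable_0[of q] ring_of_variable_2K[OF q] PInf by metis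
  next
    case (real x)
    then obtain \<rho> where \<rho>: "r = ereal \<rho>" using eq by (cases r) (auto simp: ecosh_def)
    have x: "R\<^sub>0 \<le> x" "cosh \<rho> = q * cosh x" using R0R eq real \<rho> by (auto simp: ecosh_def)
    show ?thesis
    proof (cases "q = 1 \<and> x = 0")
      case True
      then show ?thesis using K(2) ring_of_variable_2K[OF q] q1 real by (auto simp: zero_ereal_def)
    next
      case False
      define \<phi> where "\<phi> = pi / 2 - arctan (sinh \<rho>)"
      have b: "0 < \<phi>" "\<phi> < pi"
        using arctan_bounded[of "sinh \<rho>"] by (auto simp: \<phi>_def)
      have "\<phi> < am_max q"
      proof (cases "q = 1")
        case True
        then have "\<rho> > 0" using False x R0 q1 \<rho> real by auto
        then show ?thesis using True by (simp add: \<phi>_def am_max_def)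
      qed (use b in \<open>simp add: am_max_def\<close>)
      note F = elliptic_F_interior[OF q b(1) this]
      have "cos \<phi> / sin \<phi> = tan (arctan (sinh \<rho>))"
        unfolding \<phi>_def by (simp add: tan_def sin_diff cos_diff)
      then have c: "cos \<phi> / sin \<phi> = sinh \<rho>" by (simp add: tan_arctan)
      have "1 / sin \<phi> = q * cosh x" using x(2) cosh_arsinh_cot[OF b] c by (simp add: arsinh_sinh_real)
      moreover have "1 / (q * sin \<phi>) = 1 / sin \<phi> / q" by simp
      ultimately have "1 / (q * sin \<phi>) = cosh x" using q by simp
      then have "ring_of_variable q (ereal (elliptic_F q \<phi>)) = (r, R)"
        using ring_of_variable_interior[of "ereal (elliptic_F q \<phi>)"] F c x(1) R0(1)
        by (simp add: \<rho> real arcosh_cosh_real arsinh_sinh_real)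
      then show ?thesis using F by (intro bexI[of _ "ereal (elliptic_F q \<phi>)"]) auto
    qed
  qed
qed

lemma bij_betw_ring_of_variable:
  "bij_betw (ring_of_variable q) {0..2 * elliptic_K q} (ring_radii q R\<^sub>0)"
  unfolding bij_betw_def
proof
  show "ring_of_variable q ` {0..2 * elliptic_K q} = ring_radii q R\<^sub>0"
  proof
    show "ring_of_variable q ` {0..2 * elliptic_K q} \<subseteq> ring_radii q R\<^sub>0"
      using ring_of_variable_in_ring_radii by (rule image_subsetI)
    show "ring_radii q R\<^sub>0 \<subseteq> ring_of_variable q ` {0..2 * elliptic_K q}"
    proof
      fix p assume p: "p \<in> ring_radii q R\<^sub>0"
      obtain r R where "p = (r, R)" by (cases p)
      with p ring_radii_covered show "p \<in> ring_of_variable q ` {0..2 * elliptic_K q}"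
        by (metis image_eqI)
    qed
  qed
qed (rule inj_on_ring_of_variable)

end
end

theorem proposition3p1:
  fixes q R\<^sub>0 :: real
  assumes "0 < q" and "q \<le> 1"
    and "0 \<le> R\<^sub>0" and "cosh R\<^sub>0 = 1 / q"
  shows "\<exists>\<Phi>. bij_betw \<Phi> {0..2 * elliptic_K q} (ring_radii q R\<^sub>0) \<and>
    (\<forall>\<gamma>\<in>{0..2 * elliptic_K q}. \<forall>r R :: ereal.
       (\<Phi> \<gamma> = (r, R) \<longleftrightarrow>
          ext_value (2 * elliptic_K q)
            (\<lambda>t. jacobi_sn q (complex_of_real t + \<i> * complex_of_real (elliptic_K' q))) \<gamma> (ecosh R) \<and>
          ext_value (2 * elliptic_K q)
            (\<lambda>t. \<i> * jacobi_cn q (complex_of_real t + \<i> * complex_of_real (elliptic_K' q))) \<gamma> (esinh R) \<and>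
          ext_value (2 * elliptic_K q)
            (\<lambda>t. \<i> * jacobi_dn q (complex_of_real t + \<i> * complex_of_real (elliptic_K' q))) \<gamma> (esinh r)) \<and>
       (\<Phi> \<gamma> = (r, R) \<longleftrightarrow>
          ext_value (2 * elliptic_K q)
            (\<lambda>t. 1 / (complex_of_real q * jacobi_sn q (complex_of_real t))) \<gamma> (ecosh R) \<and>
          ext_value (2 * elliptic_K q)
            (\<lambda>t. jacobi_dn q (complex_of_real t)) \<gamma> (etanh R) \<and>
          ext_value (2 * elliptic_K q)
            (\<lambda>t. jacobi_cn q (complex_of_real t) / jacobi_sn q (complex_of_real t)) \<gamma> (esinh r)))"
proof (intro exI[of _ "ring_of_variable q"] conjI ballI allI)
  note q = assms(1,2)
  show "bij_betw (ring_of_variable q) {0..2 * elliptic_K q} (ring_radii q R\<^sub>0)"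
    using assms by (rule bij_betw_ring_of_variable)
  fix \<gamma> and r R :: ereal
  assume \<gamma>: "\<gamma> \<in> {0..2 * elliptic_K q}"
  note val = ext_value_ring_of_variable[OF q \<gamma>]
  note unique = ext_value_unique[OF _ _ \<gamma> two_K_pos[OF q]]
  let ?E = "\<lambda>f v. ext_value (2 * elliptic_K q) f \<gamma> v"
  have iff: "ring_of_variable q \<gamma> = (r, R) \<longleftrightarrow> ?E f1 (ecosh R) \<and> ?E f2 (w R) \<and> ?E f3 (esinh r)"
    if "?E f1 (ecosh (snd (ring_of_variable q \<gamma>)))" "?E f2 (w (snd (ring_of_variable q \<gamma>)))"
      "?E f3 (esinh (fst (ring_of_variable q \<gamma>)))" "\<And>x y. w x = w y \<Longrightarrow> x = y" for f1 f2 f3 w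
  proof
    assume "?E f1 (ecosh R) \<and> ?E f2 (w R) \<and> ?E f3 (esinh r)"
    then have "w (snd (ring_of_variable q \<gamma>)) = w R" "esinh (fst (ring_of_variable q \<gamma>)) = esinh r"
      using unique that(2,3) by blast+
    then show "ring_of_variable q \<gamma> = (r, R)"
      using that(4) by (auto simp: esinh_eq_iff prod_eq_iff)
  qed (use that in auto)
  show "ring_of_variable q \<gamma> = (r, R) \<longleftrightarrow>
    ?E (\<lambda>t. jacobi_sn q (complex_of_real t + \<i> * complex_of_real (elliptic_K' q))) (ecosh R) \<and>
    ?E (\<lambda>t. \<i> * jacobi_cn q (complex_of_real t + \<i> * complex_of_real (elliptic_K' q))) (esinh R) \<and>
    ?E (\<lambda>t. \<i> * jacobi_dn q (complex_of_real t + \<i> * complex_of_real (elliptic_K' q))) (esinh r)"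
    using jacobi_sn_shift[OF q] jacobi_cn_shift[OF q] jacobi_dn_shift[OF q]
    by (intro iff val) (simp_all add: esinh_eq_iff)
  show "ring_of_variable q \<gamma> = (r, R) \<longleftrightarrow>
    ?E (\<lambda>t. 1 / (complex_of_real q * jacobi_sn q (complex_of_real t))) (ecosh R) \<and>
    ?E (\<lambda>t. jacobi_dn q (complex_of_real t)) (etanh R) \<and>
    ?E (\<lambda>t. jacobi_cn q (complex_of_real t) / jacobi_sn q (complex_of_real t)) (esinh r)"
    using jacobi_sn_real[OF q] jacobi_cn_real[OF q] jacobi_dn_real[OF q]
    by (intro iff val) (simp_all add: etanh_eq_iff)
qed

end
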